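(* Consider the fixed-sample model with count vector $\mathbf N$, $\|\mathbf N\|_1=N$. Consider any offline dataset $D(\mathbf N)$ with $N(a^* )\ge N_*$ and any unlearning request $U=\bigcup_{i=1}^\ell U_i$, where $U_i$ consists of $k_i$ data points of arm $a_{u_i}$ for $i\in[\ell]$ (distinct arms). Let $N_{\min}=\min_{i\in[\ell]}N(a_{u_i})$ and $k_{\max}=\max_{i\in[\ell]}k_i$. Suppose $k_i\le N(a_{u_i})-\sqrt{\frac{N(a_{u_i})\ln(m/\tau)}{2}}$ for all $i\in[\ell]$ and $k_{\max}<N_{\min}$, and set $\tau=\frac1N$. Let $\gamma=\sqrt{2\ln(1.25/\delta)}/\varepsilon$ and $\gamma_0'=\frac43\sqrt{\frac{\pi\ln(Nm)}{N_{\min}-k_{\max}}}$. Then the arm $\hat a'$ returned by the multi-source unlearning algorithm (described in the context) has worst-case expected sub-optimality $\mathbb E[\mu(a^* )-\mu(\hat a')]$, and hence gives $SubOpt(\mathbf N,N_*,\{k_i\}_{i=1}^\ell,\varepsilon,\delta)$, bounded as follows. If $\gamma<\gamma_0'$, $$SubOpt(\mathbf N,N_*,\{k_i\}_{i=1}^\ell,\varepsilon,\delta)=O\left(\max\left\{\sqrt{\frac{\ln(Nm)}{N_{\min}}}+\frac{k_{\max}\gamma}{N_{\min}},\ \sqrt{\frac{\ln(Nm)}{N_*}}\right\}\right),$$ and if $\gamma\ge\gamma_0'$, $$SubOpt(\mathbf N,N_*,\{k_i\}_{i=1}^\ell,\varepsilon,\delta)=O\left(\max\left\{\sqrt{\frac{\ln(Nm)}{N_{\min}-k_{\max}}},\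 \sqrt{\frac{\ln(Nm)}{N_*}}\right\}\right),$$ where $O(\cdot)$ hides an absolute constant.
   Context: Offline stochastic multi-armed bandit: $\mathcal A=[m]$ ($m\ge2$) is the set of arms; pulling arm $a$ gives a reward in $[0,1]$ drawn from a fixed unknown distribution $R(a)$ with mean $\mu(a)$; $a^*=\arg\max_a\mu(a)$. A dataset is $D=\{(a_i,r_i)\}_{i=1}^N$ with independent $r_i\sim R(a_i)$, and $N(a)$ is the number of samples of arm $a$ in $D$. Fixed-sample model: the count vector $\mathbf N=(N(a))_{a\in\mathcal A}\in\mathbb N^m$ is fixed in advance, so the only randomness in $D(\mathbf N)$ is in the rewards; it is required that $N(a^* )\ge N_*$ for a constant $N_*$. A learning algorithm $\pi$ maps datasets to arms. An unlearning algorithm $\pi'$ maps (request, learned arm, stored statistic) to an arm $\hat a'$. The pair is $(\varepsilon,\delta)$-unlearning (UL) if for all $D$, all $U\subseteq D$ and all $A\subseteq\mathcal A$: $\Pr[\pi'(U,\pi(D),T(D))\in A]\le e^\varepsilon\Pr[\pi'(\emptyset,\pi(D\setminus U),T(D\setminus U))\in A]+\delta$ and the same with the two probabilities interchanged; $\emptyset$ here is a fictitious request and $T(D\setminus U)$ may also store information about the actual request. Requests are selected independently of the rewards of the data points, so that empirical means on $D\setminus U$ are unbiased. Define $$SubOpt(\mathbf N,N_*,\{k_i\}_{i=1}^\ell,\varepsilon,\delta)=\inf_{(\pi',\pi)\ (\varepsilon,\delta)\text{-UL}}\ \sup_{D(\mathbf N),\,U\subseteq D}\mathbb E[\mu(a^*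 )-\mu(\hat a')],$$ the supremum being over reward distributions with $N(a^* )\ge N_*$ and over requests $U=\bigcup_iU_i$ as in the statement, and the expectation over the generation of $D$ and the randomness of $\pi,\pi'$. LCB learner $\pi$ with confidence level $\tau$: for arm $a$ with $N(a)>0$ let $\hat\mu(a)$ be the empirical mean and $b(a)=\sqrt{\ln(m/\tau)/(2N(a))}$; if $N(a)=0$ let $\hat\mu(a)=0$, $b(a)=1$. Put $f_{(a)}(D)=\hat\mu(a)-b(a)$ and $\pi(D)=\hat a=\arg\max_a f_{(a)}(D)$. Multi-source unlearning algorithm (applied to the LCB learner's output): let $\gamma_0'=\frac43\sqrt{\frac{\pi\ln(m/\tau)}{N_{\min}-k_{\max}}}$ (here $\pi$ is the number). Start from $F=f(D)$. For each $i\in[\ell]$: if $\hat a=a_{u_i}$ and $\gamma<\gamma_0'$, sample $\nu\sim\mathcal N(0,\sigma^2)$ with $\sigma=\frac{3k_i}{2N(a_{u_i})}\gamma$ and replace $F_{(a_{u_i})}$ by $F_{(a_{u_i})}+\nu$; otherwise (rollback) replace $F_{(a_{u_i})}$ by $\hat\mu'(a_{u_i})-b'(a_{u_i})$, where $\hat\mu'(a_{u_i})=\frac{\hat\mu(a_{u_i})N(a_{u_i})-\sum_{(a_{u_i},r_j)\in U_i}r_j}{N(a_{u_i})-k_i}$ and $b'(a_{u_i})=\sqrt{\frac{\ln(m/\tau)}{2(N(a_{u_i})-k_i)}}$. Output $\hat a'=\arg\max_aF_{(a)}$. On the reference input $\emptyset$, $T(D\setminus U)$ stores $f(D\setminus U)$,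 $\pi(D)$, the arms $a_{u_i}$, and $k_i$, $N(a_{u_i})$; the algorithm adds to $f_{(a_{u_i})}(D\setminus U)$ noise from the same $\mathcal N(0,\sigma^2)$ exactly when $\pi(D)=a_{u_i}$ and $\gamma<\gamma_0'$, and outputs the argmax. *)

theory Defs
  imports "HOL-Probability.Probability"
begin

section \<open>Datasets and requests\<close>

text \<open>The arms are \<open>0, \<dots>, m - 1\<close>. A subset \<open>U\<close> of the data points of \<open>D\<close> is given by a set \<open>S\<close> of
  positions: \<open>U\<close> is \<open>nths D S\<close> and \<open>D\<close> without \<open>U\<close> is \<open>nths D (- S)\<close>.\<close>

type_synonym dataset = "(nat \<times> real) list"

definition is_dataset :: "nat \<Rightarrow> dataset \<Rightarrow> bool" where
  "is_dataset m D \<longleftrightarrow> (\<forall>(a, r) \<in> set D. a < m \<and> 0 \<le> r \<and> r \<le> 1)"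

definition num :: "dataset \<Rightarrow> nat \<Rightarrow> nat" where
  "num D a = length (filter (\<lambda>p. fst p = a) D)"

definition total :: "dataset \<Rightarrow> nat \<Rightarrow> real" where
  "total D a = sum_list (map snd (filter (\<lambda>p. fst p = a) D))"

definition emp_mean :: "dataset \<Rightarrow> nat \<Rightarrow> real" where
  "emp_mean D a = (if num D a = 0 then 0 else total D a / real (num D a))"

text \<open>\<open>U\<close> is the union of \<open>U\<^sub>i\<close>, \<open>i < l\<close>, where \<open>U\<^sub>i\<close> consists of \<open>k i\<close> data points of arm \<open>u i\<close>;
  \<open>arms\<close> is the sequence of arms of the data points.\<close>

definition is_request :: "nat \<Rightarrow> (nat \<Rightarrow> nat) \<Rightarrow> (nat \<Rightarrow> nat) \<Rightarrow> nat list \<Rightarrow> nat set \<Rightarrow> bool" where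
  "is_request l u k arms S \<longleftrightarrow>
     (\<exists>Us. S = (\<Union>i<l. Us i) \<and>
        (\<forall>i<l. Us i \<subseteq> {j. j < length arms \<and> arms ! j = u i} \<and> card (Us i) = k i))"


section \<open>Learning and unlearning\<close>

text \<open>What the statistic stored for the reference run may contain besides the retained data: the
  arm that was learned from the full dataset, and the number of deleted points of each arm.\<close>

type_synonym info = "nat \<times> (nat \<Rightarrow> nat)"

text \<open>The fictitious request of the reference run is \<open>None\<close>. The statistic of the actual run is
  computed before the request is known and has \<open>None\<close> as its second argument.\<close>

record 's alg_pair =
  learn :: "dataset \<Rightarrow> nat pmf"
  stat :: "dataset \<Rightarrow> info option \<Rightarrow> 's"
  unlearn :: "dataset option \<Rightarrow> nat \<Rightarrow> 's \<Rightarrow> nat pmf"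

definition actual_output :: "'s alg_pair \<Rightarrow> dataset \<Rightarrow> nat set \<Rightarrow> nat pmf" where
  "actual_output P D S =
     bind_pmf (learn P D) (\<lambda>a. unlearn P (Some (nths D S)) a (stat P D None))"

definition reference_output :: "'s alg_pair \<Rightarrow> dataset \<Rightarrow> nat set \<Rightarrow> nat pmf" where
  "reference_output P D S =
     bind_pmf (learn P D) (\<lambda>b. bind_pmf (learn P (nths D (- S))) (\<lambda>a.
       unlearn P None a (stat P (nths D (- S)) (Some (b, num (nths D S))))))"

definition UL_at :: "nat \<Rightarrow> real \<Rightarrow> real \<Rightarrow> 's alg_pair \<Rightarrow> dataset \<Rightarrow> nat set \<Rightarrow> bool" where
  "UL_at m \<epsilon> \<delta> P D S \<longleftrightarrow> (\<forall>A \<subseteq> {..<m}.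
     measure_pmf.prob (actual_output P D S) A
       \<le> exp \<epsilon> * measure_pmf.prob (reference_output P D S) A + \<delta> \<and>
     measure_pmf.prob (reference_output P D S) A
       \<le> exp \<epsilon> * measure_pmf.prob (actual_output P D S) A + \<delta>)"

definition UL :: "nat \<Rightarrow> real \<Rightarrow> real \<Rightarrow> 's alg_pair \<Rightarrow> bool" where
  "UL m \<epsilon> \<delta> P \<longleftrightarrow>
     (\<forall>D S. is_dataset m D \<longrightarrow> S \<subseteq> {..<length D} \<longrightarrow> UL_at m \<epsilon> \<delta> P D S)"

text \<open>The dataset with arm sequence \<open>arms\<close> and rewards \<open>\<omega> 0, \<omega> 1, \<dots>\<close>\<close>

definition data :: "nat list \<Rightarrow> (nat \<Rightarrow> real) \<Rightarrow> dataset" where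
  "data arms \<omega> = zip arms (map \<omega> [0..<length arms])"

text \<open>The algorithms return arms, and their output depends measurably on the rewards, so that
  expectations over the rewards make sense.\<close>

definition admissible :: "nat \<Rightarrow> 's alg_pair \<Rightarrow> bool" where
  "admissible m P \<longleftrightarrow>
     (\<forall>D. set_pmf (learn P D) \<subseteq> {..<m}) \<and>
     (\<forall>q s. \<forall>a<m. set_pmf (unlearn P q a s) \<subseteq> {..<m}) \<and>
     (\<forall>arms S a. set arms \<subseteq> {..<m} \<longrightarrow> S \<subseteq> {..<length arms} \<longrightarrow>
        (\<lambda>\<omega>. pmf (actual_output P (data arms \<omega>) S) a)
          \<in> borel_measurable (Pi\<^sub>M {..<length arms} (\<lambda>_. borel)))"


section \<open>Sub-optimality in the fixed-sample model\<close>

definition mean :: "(nat \<Rightarrow> real measure) \<Rightarrow> nat \<Rightarrow> real" where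
  "mean R a = (\<integral>x. x \<partial>(R a))"

definition best_mean :: "nat \<Rightarrow> (nat \<Rightarrow> real measure) \<Rightarrow> real" where
  "best_mean m R = Max (mean R ` {..<m})"

definition bandit_instance :: "nat \<Rightarrow> (nat \<Rightarrow> nat) \<Rightarrow> real \<Rightarrow> (nat \<Rightarrow> real measure) \<Rightarrow> bool" where
  "bandit_instance m Nv Nstar R \<longleftrightarrow>
     (\<forall>a<m. prob_space (R a) \<and> sets (R a) = sets borel \<and> (AE x in R a. 0 \<le> x \<and> x \<le> 1)) \<and>
     (\<exists>a<m. mean R a = best_mean m R \<and> Nstar \<le> real (Nv a))"

text \<open>The positions \<open>S\<close> of the request do not depend on the rewards.\<close>

definition expected_subopt ::
    "nat \<Rightarrow> nat list \<Rightarrow> (nat \<Rightarrow> real measure) \<Rightarrow> nat set \<Rightarrow> 's alg_pair \<Rightarrow> ennreal" where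
  "expected_subopt m arms R S P =
     (\<integral>\<^sup>+\<omega>. (\<integral>\<^sup>+a. ennreal (best_mean m R - mean R a) \<partial>measure_pmf (actual_output P (data arms \<omega>) S))
        \<partial>Pi\<^sub>M {..<length arms} (\<lambda>i. R (arms ! i)))"

definition worst_case_subopt ::
    "nat \<Rightarrow> (nat \<Rightarrow> nat) \<Rightarrow> real \<Rightarrow> nat \<Rightarrow> (nat \<Rightarrow> nat) \<Rightarrow> (nat \<Rightarrow> nat) \<Rightarrow> 's alg_pair \<Rightarrow> ennreal" where
  "worst_case_subopt m Nv Nstar l u k P =
     (SUP (arms, R, S) \<in> {(arms, R, S).
          set arms \<subseteq> {..<m} \<and> (\<forall>a<m. count_list arms a = Nv a) \<and>
          bandit_instance m Nv Nstar R \<and> is_request l u k arms S}.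
        expected_subopt m arms R S P)"

text \<open>Every statistic is a function of the retained dataset and the additional information, so
  nothing is lost by fixing a type of statistics that can hold both.\<close>

definition SubOpt ::
    "nat \<Rightarrow> (nat \<Rightarrow> nat) \<Rightarrow> real \<Rightarrow> nat \<Rightarrow> (nat \<Rightarrow> nat) \<Rightarrow> (nat \<Rightarrow> nat) \<Rightarrow> real \<Rightarrow> real \<Rightarrow> ennreal" where
  "SubOpt m Nv Nstar l u k \<epsilon> \<delta> =
     (INF P \<in> {P :: (dataset \<times> info option) alg_pair. admissible m P \<and> UL m \<epsilon> \<delta> P}.
        worst_case_subopt m Nv Nstar l u k P)"


section \<open>The LCB learner\<close>

text \<open>Ties are broken in favour of the smallest arm.\<close>

definition argmax :: "nat \<Rightarrow> (nat \<Rightarrow> real) \<Rightarrow> nat" where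
  "argmax m F = (LEAST a. a < m \<and> (\<forall>b<m. F b \<le> F a))"

definition bonus :: "nat \<Rightarrow> real \<Rightarrow> nat \<Rightarrow> real" where
  "bonus m \<tau> n = (if n = 0 then 1 else sqrt (ln (real m / \<tau>) / (2 * real n)))"

definition lcb :: "nat \<Rightarrow> real \<Rightarrow> dataset \<Rightarrow> nat \<Rightarrow> real" where
  "lcb m \<tau> D a = emp_mean D a - bonus m \<tau> (num D a)"

definition lcb_learner :: "nat \<Rightarrow> real \<Rightarrow> dataset \<Rightarrow> nat pmf" where
  "lcb_learner m \<tau> D = return_pmf (argmax m (lcb m \<tau> D))"


section \<open>The multi-source unlearning algorithm\<close>

text \<open>The sources are recovered from the numbers \<open>k a\<close> of deleted points of each arm \<open>a\<close>;
  \<open>N a\<close> is the number of points of arm \<open>a\<close> before deletion.\<close>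

definition sources :: "nat \<Rightarrow> (nat \<Rightarrow> nat) \<Rightarrow> nat set" where
  "sources m k = {a. a < m \<and> 0 < k a}"

definition threshold :: "nat \<Rightarrow> real \<Rightarrow> (nat \<Rightarrow> nat) \<Rightarrow> (nat \<Rightarrow> nat) \<Rightarrow> real" where
  "threshold m \<tau> N k =
     4 / 3 * sqrt (pi * ln (real m / \<tau>)
       / (real (Min (N ` sources m k)) - real (Max (k ` sources m k))))"

text \<open>Law of the argmax after adding a centred normal variable of standard deviation \<open>\<sigma>\<close> to
  the entry of arm \<open>a\<close>\<close>

definition noisy_argmax :: "nat \<Rightarrow> (nat \<Rightarrow> real) \<Rightarrow> nat \<Rightarrow> real \<Rightarrow> nat pmf" where
  "noisy_argmax m F a \<sigma> =
     Abs_pmf (distr (density lborel (\<lambda>x. ennreal (normal_density 0 \<sigma> x))) (count_space UNIV)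
       (\<lambda>\<nu>. argmax m (F(a := F a + \<nu>))))"

definition rollback ::
    "nat \<Rightarrow> real \<Rightarrow> (nat \<Rightarrow> real) \<Rightarrow> (nat \<Rightarrow> nat) \<Rightarrow> dataset \<Rightarrow> nat \<Rightarrow> real" where
  "rollback m \<tau> mu N U a =
     (mu a * real (N a) - total U a) / (real (N a) - real (num U a))
       - sqrt (ln (real m / \<tau>) / (2 * (real (N a) - real (num U a))))"

text \<open>\<open>f\<close> (lower confidence bounds), empirical means, numbers of points before deletion,
  additional information\<close>

type_synonym ms_stat = "(nat \<Rightarrow> real) \<times> (nat \<Rightarrow> real) \<times> (nat \<Rightarrow> nat) \<times> info option"

fun ms_store :: "nat \<Rightarrow> real \<Rightarrow> dataset \<Rightarrow> info option \<Rightarrow> ms_stat" where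
  "ms_store m \<tau> D None = (lcb m \<tau> D, emp_mean D, num D, None)"
| "ms_store m \<tau> D (Some (b, k)) =
     (lcb m \<tau> D, emp_mean D, (\<lambda>a. num D a + k a), Some (b, k))"

text \<open>Add noise to the entry of arm \<open>b\<close> if \<open>b\<close> is a source and \<open>\<gamma>\<close> is below the threshold, and
  take the argmax.\<close>

definition ms_select ::
    "nat \<Rightarrow> real \<Rightarrow> real \<Rightarrow> (nat \<Rightarrow> nat) \<Rightarrow> (nat \<Rightarrow> nat) \<Rightarrow> nat \<Rightarrow> (nat \<Rightarrow> real) \<Rightarrow> nat pmf" where
  "ms_select m \<tau> \<gamma> N k b F =
     (if b \<in> sources m k \<and> \<gamma> < threshold m \<tau> N k
      then noisy_argmax m F b (3 * real (k b) / (2 * real (N b)) * \<gamma>)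
      else return_pmf (argmax m F))"

text \<open>As the sources are distinct arms, the updates for the individual sources are independent of
  each other and are written as a single simultaneous update. The statistic \<open>None\<close> never occurs
  with the fictitious request.\<close>

fun ms_unlearn ::
    "nat \<Rightarrow> real \<Rightarrow> real \<Rightarrow> dataset option \<Rightarrow> nat \<Rightarrow> ms_stat \<Rightarrow> nat pmf" where
  "ms_unlearn m \<tau> \<gamma> (Some U) b (f, mu, N, _) =
     ms_select m \<tau> \<gamma> N (num U) b
       (\<lambda>a. if a \<in> sources m (num U) \<and> \<not> (a = b \<and> \<gamma> < threshold m \<tau> N (num U))
            then rollback m \<tau> mu N U a else f a)"
| "ms_unlearn m \<tau> \<gamma> None _ (f, mu, N, Some (b, k)) = ms_select m \<tau> \<gamma> N k b f"
| "ms_unlearn m \<tau> \<gamma> None _ (f, mu, N, None) = return_pmf (argmax m f)"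

definition multi_source :: "nat \<Rightarrow> real \<Rightarrow> real \<Rightarrow> ms_stat alg_pair" where
  "multi_source m \<tau> \<gamma> =
     \<lparr>learn = lcb_learner m \<tau>, stat = ms_store m \<tau>, unlearn = ms_unlearn m \<tau> \<gamma>\<rparr>"

end

theory Submission
  imports Defs
begin

text \<open>The condition on \<open>k i\<close> bounds the change of a lower confidence bound under deletion by
  \<open>3 k i / (2 N)\<close>, so at the learned arm the algorithm is a Gaussian mechanism; elsewhere the
  rollback reproduces the retained data exactly. By Hoeffding's inequality, outside an event of
  probability at most \<open>4 \<tau>\<close>, all lower confidence bounds of the full and of the retained data lie
  below the means by at most twice the bonus. There, the regret of a run with noise \<open>\<nu>\<close> is at most
  twice the bonus of the best arm on the full data plus \<open>\<bar>\<nu>\<bar>\<close>, and that of a full rollback at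
  most twice the bonus of the best arm on the retained data.\<close>

section \<open>Deleting a request\<close>

text \<open>The unlearning property of \<open>multi_source\<close> rests on the restriction on the
  deletion sizes and, through the Gaussian tail estimate, on \<open>\<epsilon> \<le> 1\<close>; it
  is therefore stated with \<open>UL_at\<close>, at requests of the given shape. The infimum in
  \<open>SubOpt\<close> ranges over pairs satisfying \<open>UL\<close> at all datasets and all
  deletions, so \<open>multi_source\<close> is not taken as competitor there: the bound on
  \<open>SubOpt\<close> comes from a second pair. The two runs are comparable because the branch
  taken depends only on the arm learned from the full data and on the counts before and after
  deletion, all of which the reference statistic can supply. Both runs take the same branch, and
  only the entry of the learned arm can differ, so a one-dimensional Gaussian estimate is enough.
  The positions of a request are fixed independently of the rewards. Hence the retained rewards of
  an arm are again independent with the right mean, and the concentration argument is the same for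
  full and retained data. The failure cost \<open>4 * \<tau>\<close>, with
  \<open>\<tau> = 1 / N\<close>, is absorbed by the term with \<open>Nstar\<close>.\<close>

lemma sum_list_filter_nths:
  fixes g :: "'a \<Rightarrow> 'b::comm_monoid_add"
  shows "sum_list (map g (filter P (nths D S)))
    = (\<Sum>i | i < length D \<and> i \<in> S \<and> P (D ! i). g (D ! i))"
proof (induction D rule: rev_induct)
  case (snoc x D)
  have "{i. i < length (D @ [x]) \<and> i \<in> S \<and> P ((D @ [x]) ! i)}
      = {i. i < length D \<and> i \<in> S \<and> P (D ! i)}
        \<union> (if length D \<in> S \<and> P x then {length D} else {})"
    by (auto simp: nth_append less_Suc_eq split: if_splits)
  moreover have "(\<Sum>i | i < length D \<and> i \<in> S \<and> P (D ! i). g ((D @ [x]) ! i))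
      = (\<Sum>i | i < length D \<and> i \<in> S \<and> P (D ! i). g (D ! i))"
    by (intro sum.cong) (auto simp: nth_append)
  ultimately show ?case
    using snoc by (auto simp: nths_append sum.union_disjoint add.commute)
qed auto

lemma num_nths: "num (nths D S) a = card {i. i < length D \<and> i \<in> S \<and> fst (D ! i) = a}"
proof -
  have "num (nths D S) a = sum_list (map (\<lambda>_. 1) (filter (\<lambda>p. fst p = a) (nths D S)))"
    by (simp add: num_def sum_list_triv)
  then show ?thesis
    unfolding sum_list_filter_nths by simp
qed

lemma total_nths:
  "total (nths D S) a = (\<Sum>i | i < length D \<and> i \<in> S \<and> fst (D ! i) = a. snd (D ! i))"
  unfolding total_def by (rule sum_list_filter_nths)

lemma nths_UNIV: "nths D UNIV = D"
  by (simp add: nths_all)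

lemma num_eq_card: "num D a = card {i. i < length D \<and> fst (D ! i) = a}"
  using num_nths[of D UNIV a] by (simp add: nths_UNIV)

lemma total_eq_sum: "total D a = (\<Sum>i | i < length D \<and> fst (D ! i) = a. snd (D ! i))"
  using total_nths[of D UNIV a] by (simp add: nths_UNIV)

lemma num_nths_compl: "num (nths D S) a + num (nths D (- S)) a = num D a"
proof -
  have "{i. i < length D \<and> fst (D ! i) = a} = {i. i < length D \<and> i \<in> S \<and> fst (D ! i) = a}
      \<union> {i. i < length D \<and> i \<in> - S \<and> fst (D ! i) = a}"
    by auto
  then show ?thesis
    unfolding num_nths num_eq_card[of D] by (subst card_Un_disjoint[symmetric]) (auto intro: arg_cong[where f = card])
qed

lemma total_nths_compl: "total (nths D S) a + total (nths D (- S)) a = total D a"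
proof -
  have "{i. i < length D \<and> fst (D ! i) = a} = {i. i < length D \<and> i \<in> S \<and> fst (D ! i) = a}
      \<union> {i. i < length D \<and> i \<in> - S \<and> fst (D ! i) = a}"
    by auto
  then show ?thesis
    unfolding total_nths total_eq_sum[of D] by (subst sum.union_disjoint[symmetric]) (auto intro: sum.cong)
qed

lemma total_bounds:
  assumes "is_dataset m D"
  shows "0 \<le> total (nths D S) a" "total (nths D S) a \<le> real (num (nths D S) a)"
proof -
  have *: "0 \<le> snd (D ! i) \<and> snd (D ! i) \<le> 1" if "i < length D" for i
    using assms nth_mem[OF that] by (force simp: is_dataset_def)
  show "0 \<le> total (nths D S) a"
    unfolding total_nths using * by (intro sum_nonneg) auto
  show "total (nths D S) a \<le> real (num (nths D S) a)"
    unfolding total_nths num_nths using * by (subst card_eq_sum, subst of_nat_sum) (intro sum_mono, auto)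
qed

text \<open>As the arms \<open>u i\<close> are distinct, \<open>Us i\<close> can be recovered from
  \<open>S\<close>: it is the set of all positions in \<open>S\<close> whose arm is
  \<open>u i\<close>. The counts thus no longer depend on the chosen decomposition.\<close>

lemma
  assumes "is_request l u k arms S" "inj_on u {..<l}"
  shows request_count: "i < l \<Longrightarrow> card {j. j < length arms \<and> j \<in> S \<and> arms ! j = u i} = k i"
    and request_other: "a \<notin> u ` {..<l} \<Longrightarrow> {j. j < length arms \<and> j \<in> S \<and> arms ! j = a} = {}"
proof -
  obtain Us where S: "S = (\<Union>i<l. Us i)"
    and Us: "\<And>i. i < l \<Longrightarrow> Us i \<subseteq> {j. j < length arms \<and> arms ! j = u i} \<and> card (Us i) = k i"
    using assms(1) by (auto simp: is_request_def)
  show "{j. j < length arms \<and> j \<in> S \<and> arms ! j = a} = {}" if "a \<notin> u ` {..<l}"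
    using Us that by (auto simp: S)
  assume i: "i < l"
  have "{j. j < length arms \<and> j \<in> S \<and> arms ! j = u i} = Us i"
  proof (intro equalityI subsetI)
    fix j assume "j \<in> {j. j < length arms \<and> j \<in> S \<and> arms ! j = u i}"
    then obtain i' where "i' < l" "j \<in> Us i'" "arms ! j = u i"
      by (auto simp: S)
    moreover from this have "u i' = u i"
      using Us[of i'] by auto
    ultimately show "j \<in> Us i"
      using i assms(2) by (metis inj_onD lessThan_iff)
  qed (use Us i in \<open>auto simp: S\<close>)
  then show "card {j. j < length arms \<and> j \<in> S \<and> arms ! j = u i} = k i"
    using Us i by simp
qed

lemma
  assumes "is_request l u k (map fst D) S" "inj_on u {..<l}"
  shows num_request: "i < l \<Longrightarrow> num (nths D S) (u i) = k i"
    and num_request_other: "a \<notin> u ` {..<l} \<Longrightarrow> num (nths D S) a = 0"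
    and total_request_other: "a \<notin> u ` {..<l} \<Longrightarrow> total (nths D S) a = 0"
proof -
  have *: "{j. j < length D \<and> j \<in> S \<and> fst (D ! j) = a}
      = {j. j < length (map fst D) \<and> j \<in> S \<and> map fst D ! j = a}" for a
    by auto
  show "i < l \<Longrightarrow> num (nths D S) (u i) = k i"
    using request_count[OF assms] unfolding num_nths * .
  show "a \<notin> u ` {..<l} \<Longrightarrow> num (nths D S) a = 0"
    using request_other[OF assms] unfolding num_nths * by simp
  show "total (nths D S) a = 0" if "a \<notin> u ` {..<l}"
    using request_other[OF assms that] unfolding total_nths * by (metis (no_types, lifting) sum.empty)
qed

text \<open>The algorithm recognizes a source by a positive number of deleted points, so
  \<open>1 \<le> k i\<close> is what makes every arm of the request visible to it.\<close>

lemma sources_request: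
  assumes "is_request l u k (map fst D) S" "inj_on u {..<l}"
    and "\<forall>i<l. u i < m" "\<forall>i<l. 1 \<le> k i"
  shows "sources m (num (nths D S)) = u ` {..<l}"
proof -
  have "a \<in> u ` {..<l}" if "0 < num (nths D S) a" for a
    using num_request_other[OF assms(1,2), of a] that by auto
  moreover have "0 < num (nths D S) (u i)" "u i < m" if "i < l" for i
    using that assms(3,4) num_request[OF assms(1,2) that] by (auto simp: Suc_le_eq)
  ultimately show ?thesis
    by (auto simp: sources_def)
qed

lemma threshold_request:
  assumes "is_request l u k (map fst D) S" "inj_on u {..<l}"
    and "\<forall>i<l. u i < m" "\<forall>i<l. 1 \<le> k i" "\<forall>a<m. num D a = Nv a"
  shows "threshold m \<tau> (num D) (num (nths D S))
    = 4 / 3 * sqrt (pi * ln (real m / \<tau>)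
        / (real (Min ((\<lambda>i. Nv (u i)) ` {..<l})) - real (Max (k ` {..<l}))))"
proof -
  have "num D ` u ` {..<l} = (\<lambda>i. Nv (u i)) ` {..<l}"
    unfolding image_image by (rule image_cong) (use assms(3,5) in auto)
  moreover have "num (nths D S) ` u ` {..<l} = k ` {..<l}"
    unfolding image_image by (rule image_cong) (use num_request[OF assms(1,2)] in auto)
  ultimately show ?thesis
    unfolding threshold_def sources_request[OF assms(1-4)] by simp
qed


section \<open>The multi-source algorithm as two noisy selections\<close>

lemma lcb_nths_compl_unaffected:
  assumes "num (nths D S) a = 0" "total (nths D S) a = 0"
  shows "lcb m \<tau> (nths D (- S)) a = lcb m \<tau> D a"
  using assms num_nths_compl[of D S a] total_nths_compl[of D S a]
  by (simp add: lcb_def emp_mean_def)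

text \<open>The strict inequality leaves at least one point of the arm, so \<open>emp_mean\<close>
  and \<open>bonus\<close> of the retained data avoid their default values at count 0.\<close>

lemma rollback_eq_lcb:
  assumes "num (nths D S) a < num D a"
  shows "rollback m \<tau> (emp_mean D) (num D) (nths D S) a = lcb m \<tau> (nths D (- S)) a"
proof -
  have "real (num (nths D (- S)) a) = real (num D a) - real (num (nths D S) a)"
    "num (nths D (- S)) a \<noteq> 0" "num D a \<noteq> 0"
    using assms num_nths_compl[of D S a] by linarith+
  moreover have "total D a - total (nths D S) a = total (nths D (- S)) a"
    using total_nths_compl[of D S a] by simp
  ultimately show ?thesis
    by (simp add: rollback_def lcb_def emp_mean_def bonus_def)
qed

lemma learn_multi_source: "learn (multi_source m \<tau> \<gamma>) D = return_pmf (argmax m (lcb m \<tau> D))"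
  by (simp add: multi_source_def lcb_learner_def)

text \<open>Adding the stored deletion counts to the retained counts restores \<open>num D\<close>;
  the reference run therefore evaluates the same threshold and the same noise scale as the actual
  run.\<close>

lemma reference_output_multi_source:
  "reference_output (multi_source m \<tau> \<gamma>) D S
     = ms_select m \<tau> \<gamma> (num D) (num (nths D S)) (argmax m (lcb m \<tau> D)) (lcb m \<tau> (nths D (- S)))"
proof -
  have "(\<lambda>a. num (nths D (- S)) a + num (nths D S) a) = num D"
    using num_nths_compl[of D S] by (simp add: add.commute fun_eq_iff)
  then show ?thesis
    by (simp add: reference_output_def learn_multi_source bind_return_pmf)
       (simp add: multi_source_def)
qed

text \<open>Rolled-back arms and untouched arms both carry the bound of the retained data. The only
  entry that may still come from the full data is that of \<open>b\<close>, and only in the noise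
  branch; this is the single difference from the reference run.\<close>

lemma actual_output_multi_source:
  fixes \<tau> \<gamma> :: real
  assumes "\<And>a. num (nths D S) a = 0 \<Longrightarrow> total (nths D S) a = 0"
    and "\<And>a. 0 < num (nths D S) a \<Longrightarrow> a < m \<and> num (nths D S) a < num D a"
  defines "b \<equiv> argmax m (lcb m \<tau> D)" and "k \<equiv> num (nths D S)" and "F \<equiv> lcb m \<tau> (nths D (- S))"
  shows "actual_output (multi_source m \<tau> \<gamma>) D S
     = ms_select m \<tau> \<gamma> (num D) k b
         (if b \<in> sources m k \<and> \<gamma> < threshold m \<tau> (num D) k then F(b := lcb m \<tau> D b) else F)"
proof -
  have "(\<lambda>a. if a \<in> sources m k \<and> \<not> (a = b \<and> \<gamma> < threshold m \<tau> (num D) k)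
            then rollback m \<tau> (emp_mean D) (num D) (nths D S) a else lcb m \<tau> D a)
     = (if b \<in> sources m k \<and> \<gamma> < threshold m \<tau> (num D) k then F(b := lcb m \<tau> D b) else F)"
  proof
    fix a
    show "(if a \<in> sources m k \<and> \<not> (a = b \<and> \<gamma> < threshold m \<tau> (num D) k)
            then rollback m \<tau> (emp_mean D) (num D) (nths D S) a else lcb m \<tau> D a)
     = (if b \<in> sources m k \<and> \<gamma> < threshold m \<tau> (num D) k then F(b := lcb m \<tau> D b) else F) a"
    proof (cases "a \<in> sources m k")
      case True
      then show ?thesis
        using assms(2)[of a] by (auto simp: rollback_eq_lcb F_def k_def sources_def)
    next
      case False
      then have "k a = 0"
        using assms(2)[of a] by (auto simp: sources_def k_def)
      then show ?thesis
        using False assms(1)[of a] by (auto simp: F_def k_def lcb_nths_compl_unaffected)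
    qed
  qed
  then show ?thesis
    unfolding actual_output_def learn_multi_source bind_return_pmf b_def[symmetric]
    by (simp add: multi_source_def k_def)
qed

text \<open>Deletion changes the mean by at most \<open>k / N\<close>; the bound on \<open>k\<close> limits the change of the bonus
  to half of that.\<close>

lemma lcb_sensitivity:
  assumes D: "is_dataset m D" and k: "num (nths D S) a < num D a"
    and "real (num (nths D S) a) \<le> real (num D a) - sqrt (real (num D a) * ln (real m / \<tau>) / 2)"
    and L: "0 \<le> ln (real m / \<tau>)"
  shows "\<bar>lcb m \<tau> D a - lcb m \<tau> (nths D (- S)) a\<bar>
    \<le> 3 * real (num (nths D S) a) / (2 * real (num D a))"
proof -
  define N n k t t' L where "N = real (num D a)" and "n = real (num (nths D (- S)) a)"
    and "k = real (num (nths D S) a)" and "t = total (nths D (- S)) a"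
    and "t' = total (nths D S) a" and "L = ln (real m / \<tau>)"
  \<comment> \<open>In terms of the square roots of the two sample sizes the bonuses become
    \<open>s / x\<close> and \<open>s / y\<close>, with \<open>y^2 - x^2 = k\<close>.\<close>
  define x y where "x = sqrt n" and "y = sqrt N"
  have N: "N = n + k" and n: "0 < n" and k0: "0 \<le> k"
    using assms(2) num_nths_compl[of D S a] by (auto simp: N_def n_def k_def)
  have nL: "sqrt (N * L / 2) \<le> n"
    using assms(3) N by (simp add: N_def n_def k_def L_def)
  have t: "0 \<le> t" "t \<le> n" "0 \<le> t'" "t' \<le> k" "total D a = t + t'"
    using total_bounds[OF D, of S a] total_bounds[OF D, of "- S" a] total_nths_compl[of D S a]
    by (auto simp: t_def t'_def n_def k_def)
  have xy: "0 < x" "x \<le> y" "x\<^sup>2 = n" "y\<^sup>2 = N"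
    using n N k0 by (auto simp: x_def y_def)
  have "\<bar>(t + t') / N - t / n\<bar> = \<bar>t' * n - t * k\<bar> / (N * n)"
    using n N k0 by (simp add: field_simps abs_divide abs_mult)
  also have "\<dots> \<le> n * k / (N * n)"
  proof (intro divide_right_mono abs_leI)
    \<comment> \<open>Both products lie between 0 and \<open>n * k\<close>, so their difference, not
      merely their sum, is what has to be bounded, and it stays within \<open>n * k\<close>.\<close>
    have "t' * n \<le> k * n" "t * k \<le> n * k" "0 \<le> t' * n" "0 \<le> t * k"
      using t n k0 by (auto intro: mult_right_mono)
    then show "t' * n - t * k \<le> n * k" "- (t' * n - t * k) \<le> n * k"
      by (auto simp: mult.commute)
  qed (use n N k0 in auto)
  finally have mean: "\<bar>(t + t') / N - t / n\<bar> \<le> k / N"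
    using n by simp
  define s where "s = sqrt (L / 2)"
  have b: "sqrt (L / (2 * N)) = s / y" "sqrt (L / (2 * n)) = s / x"
    by (simp_all add: s_def x_def y_def real_sqrt_divide real_sqrt_mult)
  have s0: "0 \<le> s"
    using L by (simp add: s_def L_def)
  \<comment> \<open>This is the restriction on the deletion size: \<open>sqrt (N * L / 2)\<close> is
    \<open>s * y\<close>, and the retained size \<open>n\<close> is \<open>x^2\<close>.\<close>
  have "s * y \<le> x\<^sup>2"
    using nL xy by (simp add: s_def y_def real_sqrt_divide real_sqrt_mult mult.commute)
  then have s: "s \<le> x\<^sup>2 / y"
    using xy by (simp add: field_simps)
  have "s / x - s / y = s * ((y - x) / (x * y))"
    using xy by (simp add: field_simps)
  also have "\<dots> \<le> x\<^sup>2 / y * ((y - x) / (x * y))"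
    using xy s by (intro mult_right_mono) auto
  also have "\<dots> = x * (y - x) / y\<^sup>2"
    using xy(1,2) by (simp add: field_simps power2_eq_square)
  also have "\<dots> \<le> (y + x) * (y - x) / (2 * y\<^sup>2)"
  proof -
    \<comment> \<open>Replacing \<open>x\<close> by the larger average of \<open>x\<close> and
      \<open>y\<close> completes a difference of squares, which equals \<open>k\<close>; the average
      supplies the factor 1/2.\<close>
    have "x * (y - x) \<le> (y + x) / 2 * (y - x)"
      using xy by (intro mult_right_mono) auto
    then have "x * (y - x) / y\<^sup>2 \<le> (y + x) / 2 * (y - x) / y\<^sup>2"
      by (intro divide_right_mono) auto
    then show ?thesis
      by simp
  qed
  also have "\<dots> = k / (2 * N)"
    using xy N by (simp add: algebra_simps power2_eq_square)
  finally have bon: "s / x - s / y \<le> k / (2 * N)" .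
  have bon0: "0 \<le> s / x - s / y"
    using xy s0 by (simp add: frac_le)
  have "lcb m \<tau> D a - lcb m \<tau> (nths D (- S)) a = ((t + t') / N - t / n) + (s / x - s / y)"
    using n N k0 t(5) by (simp add: lcb_def emp_mean_def bonus_def b[symmetric] N_def[symmetric]
      n_def[symmetric] t_def[symmetric] L_def[symmetric])
      (auto simp: N_def n_def)
  then have "\<bar>lcb m \<tau> D a - lcb m \<tau> (nths D (- S)) a\<bar> \<le> k / N + k / (2 * N)"
    using mean bon bon0 by linarith
  also have "k / N + k / (2 * N) = 3 * k / (2 * N)"
    by simp
  finally show ?thesis
    by (simp add: N_def k_def)
qed


section \<open>Noisy maximization\<close>

lemma argmax_props:
  assumes "0 < m"
  shows argmax_less: "argmax m F < m" and argmax_ge: "b < m \<Longrightarrow> F b \<le> F (argmax m F)"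
proof -
  have "Max (F ` {..<m}) \<in> F ` {..<m}"
    using assms by (intro Max_in) auto
  then obtain a where "a < m" "F a = Max (F ` {..<m})"
    by auto
  then have "\<exists>a. a < m \<and> (\<forall>b<m. F b \<le> F a)"
    by (intro exI[of _ a]) auto
  then have "argmax m F < m \<and> (\<forall>b<m. F b \<le> F (argmax m F))"
    unfolding argmax_def by (rule LeastI_ex)
  then show "argmax m F < m" "b < m \<Longrightarrow> F b \<le> F (argmax m F)"
    by auto
qed

text \<open>The tie-breaking rule turns the selection of an arm into finitely many comparisons of
  entries, from which measurability can be read off.\<close>

lemma argmax_eq_iff:
  assumes "0 < m"
  shows "argmax m F = a \<longleftrightarrow> a < m \<and> (\<forall>b<m. F b \<le> F a) \<and> (\<forall>b<a. F b < F a)"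
proof (intro iffI conjI)
  assume a: "argmax m F = a"
  then show "a < m" "\<forall>b<m. F b \<le> F a"
    using argmax_props[OF assms] by auto
  show "\<forall>b<a. F b < F a"
  proof (intro allI impI, rule ccontr)
    fix b assume "b < a" "\<not> F b < F a"
    then have "b < m \<and> (\<forall>c<m. F c \<le> F b)"
      using \<open>a < m\<close> \<open>\<forall>b<m. F b \<le> F a\<close> by (meson le_less_trans less_trans linorder_not_less order_trans)
    then have "argmax m F \<le> b"
      unfolding argmax_def by (rule Least_le)
    with a \<open>b < a\<close> show False by simp
  qed
next
  assume a: "a < m \<and> (\<forall>b<m. F b \<le> F a) \<and> (\<forall>b<a. F b < F a)"
  show "argmax m F = a"
    unfolding argmax_def
  proof (rule Least_equality)
    fix b assume b: "b < m \<and> (\<forall>c<m. F c \<le> F b)"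
    show "a \<le> b"
    proof (rule ccontr)
      assume "\<not> a \<le> b"
      then have "F b < F a" "F a \<le> F b"
        using a b by auto
      then show False by simp
    qed
  qed (use a in auto)
qed

lemma measurable_argmax:
  assumes "0 < m" "\<And>a. a < m \<Longrightarrow> (\<lambda>x. F x a) \<in> borel_measurable M"
  shows "(\<lambda>x. argmax m (F x)) \<in> M \<rightarrow>\<^sub>M count_space UNIV"
proof -
  have "(\<lambda>x. argmax m (F x)) -` {a} \<inter> space M \<in> sets M" for a
  proof (cases "a < m")
    case True
    then have "(\<lambda>x. argmax m (F x)) -` {a} \<inter> space M
        = {x \<in> space M. (\<forall>b\<in>{..<m}. F x b \<le> F x a) \<and> (\<forall>b\<in>{..<a}. F x b < F x a)}"
      unfolding vimage_def by (auto simp: argmax_eq_iff[OF assms(1)])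
    moreover have "{x \<in> space M. (\<forall>b\<in>{..<m}. F x b \<le> F x a) \<and> (\<forall>b\<in>{..<a}. F x b < F x a)} \<in> sets M"
    proof -
      have [measurable]: "(\<lambda>x. F x b) \<in> borel_measurable M" if "b \<in> {..<m}" for b
        using assms(2) that by auto
      have [measurable]: "(\<lambda>x. F x b) \<in> borel_measurable M" if "b \<in> {..<a}" for b
        using assms(2) that True by auto
      have [measurable]: "(\<lambda>x. F x a) \<in> borel_measurable M"
        using assms(2) True by auto
      show ?thesis by measurable
    qed
    ultimately show ?thesis by simp
  next
    case False
    then have "(\<lambda>x. argmax m (F x)) -` {a} \<inter> space M = {}"
      using argmax_less[OF assms(1)] by auto
    then show ?thesis by simp
  qed
  then show ?thesis
    by (subst measurable_count_space_eq2_countable) auto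
qed

text \<open>\<open>Abs_pmf\<close> is meaningful only on probability measures over all sets that are
  concentrated on points of positive mass. Positivity of \<open>\<sigma>\<close> gives total mass 1,
  and countability of the arms gives the concentration.\<close>

lemma measure_pmf_noisy_argmax:
  assumes "0 < m" "0 < \<sigma>"
  shows "measure_pmf (noisy_argmax m F a \<sigma>) =
    distr (density lborel (normal_density 0 \<sigma>)) (count_space UNIV) (\<lambda>\<nu>. argmax m (F(a := F a + \<nu>)))"
    (is "_ = ?D")
proof -
  have meas: "(\<lambda>\<nu>. argmax m (F(a := F a + \<nu>))) \<in> density lborel (normal_density 0 \<sigma>) \<rightarrow>\<^sub>M count_space UNIV"
    using assms(1) by (intro measurable_argmax) (auto simp: fun_upd_def)
  interpret N: prob_space "density lborel (normal_density 0 \<sigma>)"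
    using assms(2) by (rule prob_space_normal_density)
  interpret D: prob_space ?D
    by (rule N.prob_space_distr[OF meas])
  have "{x. measure ?D {x} = 0} \<in> null_sets ?D"
  proof -
    have "(\<Union>x\<in>{x. measure ?D {x} = 0}. {x}) \<in> null_sets ?D"
      by (intro null_sets_UN') (auto simp: null_sets_def D.emeasure_eq_measure)
    then show ?thesis by simp
  qed
  then have "AE x in ?D. measure ?D {x} \<noteq> 0"
    by (rule AE_I') auto
  then have "?D \<in> {M. prob_space M \<and> sets M = UNIV \<and> (AE x in M. measure M {x} \<noteq> 0)}"
    using D.prob_space_axioms by simp
  then show ?thesis
    unfolding noisy_argmax_def by (rule Abs_pmf_inverse)
qed

lemma set_pmf_noisy_argmax:
  assumes "0 < m" "0 < \<sigma>"
  shows "set_pmf (noisy_argmax m F a \<sigma>) \<subseteq> {..<m}"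
proof
  fix x assume "x \<in> set_pmf (noisy_argmax m F a \<sigma>)"
  then have "emeasure (measure_pmf (noisy_argmax m F a \<sigma>)) {x} \<noteq> 0"
    by (simp add: emeasure_pmf_single set_pmf_eq)
  moreover have "(\<lambda>\<nu>. argmax m (F(a := F a + \<nu>))) \<in> density lborel (normal_density 0 \<sigma>) \<rightarrow>\<^sub>M count_space UNIV"
    using assms(1) by (intro measurable_argmax) (auto simp: fun_upd_def)
  ultimately have "(\<lambda>\<nu>. argmax m (F(a := F a + \<nu>))) -` {x} \<noteq> {}"
    unfolding measure_pmf_noisy_argmax[OF assms] by (auto simp: emeasure_distr)
  then show "x \<in> {..<m}"
    using argmax_less[OF assms(1)] by auto
qed


section \<open>The Gaussian mechanism\<close>

lemma nn_integral_normal_density: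
  "0 < \<sigma> \<Longrightarrow> (\<integral>\<^sup>+x. ennreal (normal_density \<mu> \<sigma> x) \<partial>lborel) = 1"
  by (subst nn_integral_eq_integral) auto

lemma normal_lower_tail_eq_upper_tail:
  "(\<integral>\<^sup>+x. ennreal (normal_density 0 \<sigma> x) * indicator {..< - t} x \<partial>lborel)
    = (\<integral>\<^sup>+x. ennreal (normal_density 0 \<sigma> x) * indicator {t<..} x \<partial>lborel)"
  by (subst nn_integral_real_affine[where c = "-1" and t = 0])
     (auto simp: normal_density_def indicator_def intro!: nn_integral_cong)

lemma normal_upper_half:
  assumes "0 < \<sigma>"
  shows "(\<integral>\<^sup>+x. ennreal (normal_density 0 \<sigma> x) * indicator {0<..} x \<partial>lborel) \<le> ennreal (1 / 2)"
    (is "?I \<le> _")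
proof -
  \<comment> \<open>By reflection the open lower half-line has the same mass as the upper one; the
    two are disjoint.\<close>
  have "2 * ?I = (\<integral>\<^sup>+x. ennreal (normal_density 0 \<sigma> x) * indicator {..< - 0} x \<partial>lborel) + ?I"
    unfolding normal_lower_tail_eq_upper_tail by (simp add: mult_2)
  also have "\<dots> \<le> (\<integral>\<^sup>+x. ennreal (normal_density 0 \<sigma> x) \<partial>lborel)"
    by (subst nn_integral_add[symmetric]) (auto intro!: nn_integral_mono simp: indicator_def)
  also have "\<dots> = ennreal (2 * (1 / 2))"
    using assms by (simp add: nn_integral_normal_density)
  also have "\<dots> = 2 * ennreal (1 / 2)"
    by (subst ennreal_mult) auto
  finally show ?thesis
    by (subst (asm) ennreal_mult_le_mult_iff) auto
qed

text \<open>Shifting by \<open>t * \<sigma>\<close> multiplies the density at a positive point by at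
  most \<open>exp (- t^2 / 2)\<close>, since the cross term of the square is nonnegative.
  Integrating over the upper half-line keeps the factor 1/2, which is needed for the constant 1.25
  later.\<close>

lemma normal_upper_tail:
  assumes "0 < \<sigma>" "0 \<le> t"
  shows "(\<integral>\<^sup>+x. ennreal (normal_density 0 \<sigma> x) * indicator {t * \<sigma><..} x \<partial>lborel)
    \<le> ennreal (exp (- t\<^sup>2 / 2) / 2)"
proof -
  have "normal_density 0 \<sigma> (t * \<sigma> + x) \<le> exp (- t\<^sup>2 / 2) * normal_density 0 \<sigma> x" if "0 < x" for x
  proof -
    have "(t * \<sigma>)\<^sup>2 + x\<^sup>2 \<le> (t * \<sigma> + x)\<^sup>2"
      using assms that by (simp add: power2_sum)
    then have "- (t * \<sigma> + x)\<^sup>2 / (2 * \<sigma>\<^sup>2) \<le> - ((t * \<sigma>)\<^sup>2 + x\<^sup>2) / (2 * \<sigma>\<^sup>2)"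
      by (intro divide_right_mono) auto
    also have "\<dots> = - t\<^sup>2 / 2 + - x\<^sup>2 / (2 * \<sigma>\<^sup>2)"
      using assms by (simp add: field_simps)
    finally have "exp (- (t * \<sigma> + x)\<^sup>2 / (2 * \<sigma>\<^sup>2)) \<le> exp (- t\<^sup>2 / 2) * exp (- x\<^sup>2 / (2 * \<sigma>\<^sup>2))"
      by (simp flip: exp_add)
    then show ?thesis
      by (simp add: normal_density_def divide_right_mono)
  qed
  then have "(\<integral>\<^sup>+x. ennreal (normal_density 0 \<sigma> (t * \<sigma> + x)) * indicator {0<..} x \<partial>lborel)
      \<le> (\<integral>\<^sup>+x. ennreal (exp (- t\<^sup>2 / 2)) * (ennreal (normal_density 0 \<sigma> x) * indicator {0<..} x) \<partial>lborel)"
    by (intro nn_integral_mono) (auto simp: indicator_def simp flip: ennreal_mult intro!: ennreal_leI)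
  also have "\<dots> \<le> ennreal (exp (- t\<^sup>2 / 2)) * ennreal (1 / 2)"
    using normal_upper_half[OF assms(1)] by (simp add: nn_integral_cmult mult_left_mono)
  also have "\<dots> = ennreal (exp (- t\<^sup>2 / 2) / 2)"
    by (subst ennreal_mult[symmetric]) auto
  finally show ?thesis
    by (subst nn_integral_real_affine[where c = 1 and t = "t * \<sigma>"]) (auto simp: indicator_def)
qed

text \<open>To the upper half-line is added an interval of length \<open>t * \<sigma>\<close>, on
  which the density is at most \<open>1 / (2 * \<sigma>)\<close> because
  \<open>2 * pi \<ge> 4\<close>.\<close>

lemma normal_upper_tail_neg:
  assumes "0 < \<sigma>" "0 \<le> t"
  shows "(\<integral>\<^sup>+x. ennreal (normal_density 0 \<sigma> x) * indicator {- t * \<sigma><..} x \<partial>lborel)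
    \<le> ennreal (1 / 2 + t / 2)"
proof -
  have "1 / sqrt (2 * pi * \<sigma>\<^sup>2) \<le> 1 / (2 * \<sigma>)"
  proof (rule divide_left_mono)
    have "2 * \<sigma> = sqrt (4 * \<sigma>\<^sup>2)"
      using assms by (simp add: real_sqrt_mult)
    also have "\<dots> \<le> sqrt (2 * pi * \<sigma>\<^sup>2)"
      using pi_ge_two by (intro real_sqrt_le_mono mult_right_mono) auto
    finally show "2 * \<sigma> \<le> sqrt (2 * pi * \<sigma>\<^sup>2)" .
  qed (use assms in auto)
  then have "1 / sqrt (2 * pi * \<sigma>\<^sup>2) * exp (- (x - 0)\<^sup>2 / (2 * \<sigma>\<^sup>2)) \<le> 1 / (2 * \<sigma>) * 1" for x
    using assms by (intro mult_mono) auto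
  then have dens: "normal_density 0 \<sigma> x \<le> 1 / (2 * \<sigma>)" for x
    by (simp add: normal_density_def)
  have "(\<integral>\<^sup>+x. ennreal (normal_density 0 \<sigma> x) * indicator {- t * \<sigma><..} x \<partial>lborel)
      \<le> (\<integral>\<^sup>+x. ennreal (normal_density 0 \<sigma> x) * indicator {0<..} x
            + ennreal (1 / (2 * \<sigma>)) * indicator {- t * \<sigma><..0} x \<partial>lborel)"
    by (intro nn_integral_mono) (auto simp: indicator_def intro!: ennreal_leI dens)
  also have "\<dots> \<le> ennreal (1 / 2) + ennreal (1 / (2 * \<sigma>)) * ennreal (t * \<sigma>)"
    using assms normal_upper_half[OF assms(1)]
    by (subst nn_integral_add) (auto simp: nn_integral_cmult intro!: add_mono)
  also have "\<dots> = ennreal (1 / 2) + ennreal (t / 2)"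
    using assms by (subst ennreal_mult[symmetric]) auto
  also have "\<dots> = ennreal (1 / 2 + t / 2)"
    using assms by (subst ennreal_plus) auto
  finally show ?thesis .
qed

text \<open>By the choice of \<open>c\<close>, \<open>exp (- c^2 / 2)\<close> equals
  \<open>\<delta> / 1.25\<close>. The cutoff \<open>c - 1 / (2 * c)\<close> may be negative when
  \<open>\<delta>\<close> is close to 1, so the two signs need different tail bounds.\<close>

lemma normal_tail_le_delta:
  assumes "0 < \<sigma>" "0 < \<delta>" "\<delta> < 1" and c: "c = sqrt (2 * ln (1.25 / \<delta>))" and t: "c - 1 / (2 * c) \<le> t"
  shows "(\<integral>\<^sup>+x. ennreal (normal_density 0 \<sigma> x) * indicator {t * \<sigma><..} x \<partial>lborel) \<le> ennreal \<delta>"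
proof -
  define s where "s = c - 1 / (2 * c)"
  \<comment> \<open>As \<open>\<delta> < 1\<close>, the logarithm is at least
    \<open>1 - 0.8\<close>. Thus \<open>c^2 \<ge> 0.4\<close>, and 0.63 is a lower bound for
    \<open>c\<close> because \<open>0.63^2 = 0.3969\<close>.\<close>
  have "1 - 1 / (1.25 / \<delta>) \<le> ln (1.25 / \<delta>)"
    using assms ln_le_minus_one[of "1 / (1.25 / \<delta>)"] by (simp add: ln_div)
  moreover have "1 / (1.25 / \<delta>) \<le> 0.8"
    using assms by (simp add: field_simps)
  ultimately have ln: "0.2 \<le> ln (1.25 / \<delta>)"
    by linarith
  then have c2: "c\<^sup>2 = 2 * ln (1.25 / \<delta>)" and "0.4 \<le> c\<^sup>2"
    by (auto simp: c)
  have "0 < c"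
    using ln by (simp add: c)
  have "0.63 \<le> c"
  proof (rule ccontr)
    assume "\<not> 0.63 \<le> c"
    then have "c\<^sup>2 < 0.63\<^sup>2"
      using \<open>0 < c\<close> by (intro power_strict_mono) auto
    then show False
      using \<open>0.4 \<le> c\<^sup>2\<close> by (simp add: power2_eq_square)
  qed
  have delta: "exp (- c\<^sup>2 / 2) = \<delta> / 1.25"
    using assms(2) unfolding c2 by (simp add: exp_minus)
  have "(\<integral>\<^sup>+x. ennreal (normal_density 0 \<sigma> x) * indicator {t * \<sigma><..} x \<partial>lborel)
    \<le> (\<integral>\<^sup>+x. ennreal (normal_density 0 \<sigma> x) * indicator {s * \<sigma><..} x \<partial>lborel)"
  proof (intro nn_integral_mono mult_left_mono)
    have "s * \<sigma> \<le> t * \<sigma>"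
      using assms(1) t by (simp add: s_def)
    then show "indicator {t * \<sigma><..} x \<le> (indicator {s * \<sigma><..} x :: ennreal)" for x
      by (auto simp: indicator_def)
  qed simp
  also have "\<dots> \<le> ennreal \<delta>"
  proof (cases "0 \<le> s")
    case True
    \<comment> \<open>Lowering the cutoff from \<open>c\<close> to \<open>s\<close> costs at most a
      factor \<open>exp (1 / 2) \<le> 2\<close>, which cancels the 1/2 in the tail bound and leaves
      \<open>\<delta> / 1.25\<close>.\<close>
    have "s\<^sup>2 = c\<^sup>2 - 1 + (1 / (2 * c))\<^sup>2"
      using \<open>0 < c\<close> by (simp add: s_def power2_diff)
    then have "c\<^sup>2 - 1 \<le> s\<^sup>2"
      by simp
    then have "exp (- s\<^sup>2 / 2) \<le> exp (- c\<^sup>2 / 2 + 1 / 2)"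
      by simp
    also have "\<dots> \<le> \<delta> / 1.25 * 2"
      unfolding exp_add delta using exp_half_le2 assms(2) by (intro mult_left_mono) auto
    finally have "exp (- s\<^sup>2 / 2) / 2 \<le> \<delta>"
      using assms(2) by simp
    then show ?thesis
      using normal_upper_tail[OF assms(1) True] by (meson ennreal_leI order_trans)
  next
    case False
    \<comment> \<open>A negative \<open>s\<close> forces \<open>c^2 < 1 / 2\<close> and hence
      \<open>\<delta> \<ge> 0.9375\<close>, while the cutoff is no lower than -0.2. The crude bound
      \<open>1 / 2 + 0.1\<close> then suffices.\<close>
    have "1 / (2 * c) \<le> 1 / (2 * 0.63)"
      using \<open>0.63 \<le> c\<close> by (intro divide_left_mono) auto
    then have "- s \<le> 0.2"
      using \<open>0.63 \<le> c\<close> by (simp add: s_def)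
    have "c < 1 / (2 * c)"
      using False by (simp add: s_def)
    then have "c\<^sup>2 < 1 / 2"
      using \<open>0 < c\<close> by (simp add: field_simps power2_eq_square)
    then have "0.75 \<le> \<delta> / 1.25"
      using exp_ge_add_one_self[of "- c\<^sup>2 / 2"] unfolding delta by simp
    then have "1 / 2 + (- s) / 2 \<le> \<delta>"
      using \<open>- s \<le> 0.2\<close> by simp
    then show ?thesis
      using normal_upper_tail_neg[OF assms(1), of "- s"] False
      by (simp add: order_trans[OF _ ennreal_leI])
  qed
  finally show ?thesis .
qed

text \<open>The normal density at \<open>\<nu>\<close> exceeds \<open>exp \<epsilon>\<close> times its value at \<open>\<nu> + h\<close> only beyond \<open>t \<sigma>\<close> in
  the direction of \<open>h\<close>, where \<open>t = c - 1 / (2 c)\<close>.\<close>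

lemma gaussian_mechanism_nn:
  assumes "0 < \<sigma>" "0 < \<delta>" "\<delta> < 1" "0 < \<epsilon>" "\<epsilon> \<le> 1"
    and h: "\<bar>x - y\<bar> * (sqrt (2 * ln (1.25 / \<delta>)) / \<epsilon>) \<le> \<sigma>" and [measurable]: "X \<in> sets borel"
  shows "(\<integral>\<^sup>+\<nu>. ennreal (normal_density 0 \<sigma> \<nu>) * indicator X (x + \<nu>) \<partial>lborel)
    \<le> ennreal (exp \<epsilon>) * (\<integral>\<^sup>+\<nu>. ennreal (normal_density 0 \<sigma> \<nu>) * indicator X (y + \<nu>) \<partial>lborel) + ennreal \<delta>"
proof -
  define c where "c = sqrt (2 * ln (1.25 / \<delta>))"
  define h where "h = x - y"
  define t where "t = c - 1 / (2 * c)"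
  define B where "B = {\<nu>. \<epsilon> * \<sigma>\<^sup>2 - h\<^sup>2 / 2 < \<nu> * h}"
  have [measurable]: "B \<in> sets borel"
    unfolding B_def by simp
  have "0 < c"
    using assms by (simp add: c_def)
  have hle: "\<bar>h\<bar> * c \<le> \<sigma> * \<epsilon>"
    using assms(6) assms(4) by (simp add: h_def c_def field_simps)
  \<comment> \<open>Stated for a positive shift \<open>e\<close>, to be used with \<open>h\<close>
    and, after reflecting the point, with \<open>- h\<close>.\<close>
  have far: "t * \<sigma> < z" if "0 < e" "e * c \<le> \<sigma> * \<epsilon>" "\<epsilon> * \<sigma>\<^sup>2 - e\<^sup>2 / 2 < z * e" for z e
  proof -
    have "\<epsilon> * \<sigma>\<^sup>2 / e - e / 2 < z"
      using that by (simp add: field_simps power2_eq_square)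
    moreover have "\<sigma> * c \<le> \<epsilon> * \<sigma>\<^sup>2 / e"
      using mult_right_mono[OF that(2), of \<sigma>] that(1) assms(1) by (simp add: field_simps power2_eq_square)
    \<comment> \<open>Here \<open>\<epsilon> \<le> 1\<close> enters: it weakens
      \<open>e * c \<le> \<sigma> * \<epsilon>\<close> to \<open>e * c \<le> \<sigma>\<close>, so
      that the quadratic correction is at most \<open>\<sigma> / (2 * c)\<close>.\<close>
    moreover have "e / 2 \<le> \<sigma> / (2 * c)"
      using order_trans[OF that(2) mult_left_le[OF assms(5)]] \<open>0 < c\<close> assms(1)
      by (simp add: field_simps)
    moreover have "t * \<sigma> = \<sigma> * c - \<sigma> / (2 * c)"
      by (simp add: t_def algebra_simps)
    ultimately show ?thesis
      by linarith
  qed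
  have tail: "(\<integral>\<^sup>+\<nu>. ennreal (normal_density 0 \<sigma> \<nu>) * indicator B \<nu> \<partial>lborel) \<le> ennreal \<delta>"
  proof (cases "0 < h")
    case True
    then have "B \<subseteq> {t * \<sigma><..}"
      using far hle by (auto simp: B_def)
    then have "(\<integral>\<^sup>+\<nu>. ennreal (normal_density 0 \<sigma> \<nu>) * indicator B \<nu> \<partial>lborel)
        \<le> (\<integral>\<^sup>+x. ennreal (normal_density 0 \<sigma> x) * indicator {t * \<sigma><..} x \<partial>lborel)"
      by (intro nn_integral_mono mult_left_mono) (auto simp: indicator_def)
    also have "\<dots> \<le> ennreal \<delta>"
      using assms by (intro normal_tail_le_delta[OF _ _ _ c_def]) (auto simp: t_def)
    finally show ?thesis .
  next
    case False
    have "B \<subseteq> {..< - (t * \<sigma>)}"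
    proof
      fix z assume z: "z \<in> B"
      then have "h \<noteq> 0"
        using assms by (auto simp: B_def mult_less_0_iff)
      then have "t * \<sigma> < - z"
        using False hle z by (intro far[of "- h"]) (auto simp: B_def)
      then show "z \<in> {..< - (t * \<sigma>)}" by simp
    qed
    then have "(\<integral>\<^sup>+\<nu>. ennreal (normal_density 0 \<sigma> \<nu>) * indicator B \<nu> \<partial>lborel)
        \<le> (\<integral>\<^sup>+x. ennreal (normal_density 0 \<sigma> x) * indicator {..< - (t * \<sigma>)} x \<partial>lborel)"
      by (intro nn_integral_mono mult_left_mono) (auto simp: indicator_def)
    also have "\<dots> = (\<integral>\<^sup>+x. ennreal (normal_density 0 \<sigma> x) * indicator {t * \<sigma><..} x \<partial>lborel)"
      by (rule normal_lower_tail_eq_upper_tail)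
    also have "\<dots> \<le> ennreal \<delta>"
      using assms by (intro normal_tail_le_delta[OF _ _ _ c_def]) (auto simp: t_def)
    finally show ?thesis .
  qed
  have "normal_density 0 \<sigma> \<nu> \<le> exp \<epsilon> * normal_density 0 \<sigma> (h + \<nu>)" if "\<nu> \<notin> B" for \<nu>
  proof -
    have "(h + \<nu>)\<^sup>2 / (2 * \<sigma>\<^sup>2) \<le> (2 * \<epsilon> * \<sigma>\<^sup>2 + \<nu>\<^sup>2) / (2 * \<sigma>\<^sup>2)"
      using that by (intro divide_right_mono) (auto simp: B_def power2_sum algebra_simps)
    also have "\<dots> = \<epsilon> + \<nu>\<^sup>2 / (2 * \<sigma>\<^sup>2)"
      using assms(1) by (simp add: field_simps)
    finally have "exp (- \<nu>\<^sup>2 / (2 * \<sigma>\<^sup>2)) \<le> exp \<epsilon> * exp (- (h + \<nu>)\<^sup>2 / (2 * \<sigma>\<^sup>2))"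
      by (simp flip: exp_add)
    then show ?thesis
      by (simp add: normal_density_def divide_right_mono)
  qed
  \<comment> \<open>Off \<open>B\<close> the density ratio is bounded by
    \<open>exp \<epsilon>\<close>; on \<open>B\<close> the whole mass is charged to
    \<open>\<delta>\<close>. Since \<open>x + \<nu> = y + (h + \<nu>)\<close>, translation by
    \<open>h\<close> then turns the first integral into the one for \<open>y\<close>.\<close>
  then have "(\<integral>\<^sup>+\<nu>. ennreal (normal_density 0 \<sigma> \<nu>) * indicator X (x + \<nu>) \<partial>lborel)
      \<le> (\<integral>\<^sup>+\<nu>. ennreal (exp \<epsilon>) * (ennreal (normal_density 0 \<sigma> (h + \<nu>)) * indicator X (y + (h + \<nu>)))
            + ennreal (normal_density 0 \<sigma> \<nu>) * indicator B \<nu> \<partial>lborel)"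
    by (intro nn_integral_mono)
       (auto simp: indicator_def h_def simp flip: ennreal_mult intro!: ennreal_leI)
  also have "\<dots> = ennreal (exp \<epsilon>) * (\<integral>\<^sup>+\<nu>. ennreal (normal_density 0 \<sigma> (h + \<nu>)) * indicator X (y + (h + \<nu>)) \<partial>lborel)
        + (\<integral>\<^sup>+\<nu>. ennreal (normal_density 0 \<sigma> \<nu>) * indicator B \<nu> \<partial>lborel)"
    by (simp add: nn_integral_add nn_integral_cmult)
  also have "(\<integral>\<^sup>+\<nu>. ennreal (normal_density 0 \<sigma> (h + \<nu>)) * indicator X (y + (h + \<nu>)) \<partial>lborel)
      = (\<integral>\<^sup>+\<nu>. ennreal (normal_density 0 \<sigma> \<nu>) * indicator X (y + \<nu>) \<partial>lborel)"
    by (subst (2) nn_integral_real_affine[where c = 1 and t = h]) auto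
  finally show ?thesis
    using tail by (meson add_left_mono order_trans)
qed

text \<open>With all other entries fixed, the selected arm is a function of the one perturbed entry.
  The event \<open>A\<close> pulls back to a Borel set of reals, and the guarantee survives as
  post-processing of a scalar Gaussian mechanism.\<close>

lemma noisy_argmax_indistinguishable:
  assumes "0 < m" "0 < \<sigma>" "0 < \<delta>" "\<delta> < 1" "0 < \<epsilon>" "\<epsilon> \<le> 1"
    and h: "\<bar>x - y\<bar> * (sqrt (2 * ln (1.25 / \<delta>)) / \<epsilon>) \<le> \<sigma>"
  shows "measure_pmf.prob (noisy_argmax m (F(b := x)) b \<sigma>) A
    \<le> exp \<epsilon> * measure_pmf.prob (noisy_argmax m (F(b := y)) b \<sigma>) A + \<delta>"
proof -
  define X where "X = {z. argmax m (F(b := z)) \<in> A}"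
  have meas: "(\<lambda>z. argmax m (F(b := z))) \<in> borel \<rightarrow>\<^sub>M count_space UNIV"
    using assms(1) by (intro measurable_argmax) (auto simp: fun_upd_def)
  then have X: "X \<in> sets borel"
    unfolding X_def using measurable_sets[OF meas, of A] by (simp add: vimage_def)
  have "emeasure (measure_pmf (noisy_argmax m (F(b := z)) b \<sigma>)) A
      = (\<integral>\<^sup>+\<nu>. ennreal (normal_density 0 \<sigma> \<nu>) * indicator X (z + \<nu>) \<partial>lborel)" for z
  proof -
    have m: "(\<lambda>\<nu>. argmax m (F(b := z + \<nu>))) \<in> density lborel (normal_density 0 \<sigma>) \<rightarrow>\<^sub>M count_space UNIV"
      using assms(1) by (intro measurable_argmax) (auto simp: fun_upd_def)
    have "emeasure (measure_pmf (noisy_argmax m (F(b := z)) b \<sigma>)) A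
      = emeasure (density lborel (normal_density 0 \<sigma>)) ((\<lambda>\<nu>. argmax m (F(b := z + \<nu>))) -` A)"
      unfolding measure_pmf_noisy_argmax[OF assms(1,2)] using m by (simp add: emeasure_distr)
    also have "(\<lambda>\<nu>. argmax m (F(b := z + \<nu>))) -` A = (\<lambda>\<nu>. z + \<nu>) -` X"
      by (auto simp: X_def)
    also have "emeasure (density lborel (normal_density 0 \<sigma>)) \<dots>
      = (\<integral>\<^sup>+\<nu>. ennreal (normal_density 0 \<sigma> \<nu>) * indicator ((\<lambda>\<nu>. z + \<nu>) -` X) \<nu> \<partial>lborel)"
      using X measurable_sets[of "\<lambda>\<nu>. z + \<nu>" borel borel X] by (subst emeasure_density) auto
    finally show ?thesis
      by (simp only: indicator_def vimage_eq)
  qed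
  then have "ennreal (measure_pmf.prob (noisy_argmax m (F(b := x)) b \<sigma>) A)
    \<le> ennreal (exp \<epsilon>) * ennreal (measure_pmf.prob (noisy_argmax m (F(b := y)) b \<sigma>) A) + ennreal \<delta>"
    using gaussian_mechanism_nn[OF assms(2-7) X] by (simp flip: measure_pmf.emeasure_eq_measure)
  also have "\<dots> = ennreal (exp \<epsilon> * measure_pmf.prob (noisy_argmax m (F(b := y)) b \<sigma>) A + \<delta>)"
    using assms by (simp flip: ennreal_mult ennreal_plus)
  finally show ?thesis
    using assms by (subst (asm) ennreal_le_iff) auto
qed

text \<open>The exact value is \<open>\<sigma> * sqrt (2 / pi)\<close>; this is the expected regret
  that the noise contributes.\<close>

lemma normal_abs_moment:
  assumes "0 < \<sigma>"
  shows "(\<integral>\<^sup>+\<nu>. ennreal \<bar>\<nu>\<bar> \<partial>density lborel (normal_density 0 \<sigma>)) \<le> ennreal \<sigma>"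
proof -
  have *: "has_bochner_integral lborel (\<lambda>x. normal_density 0 \<sigma> x * \<bar>x\<bar>) (\<sigma> * sqrt (2 / pi))"
    using normal_moment_abs_odd[OF assms, of 0 0] by simp
  have "(\<integral>\<^sup>+\<nu>. ennreal \<bar>\<nu>\<bar> \<partial>density lborel (normal_density 0 \<sigma>))
      = (\<integral>\<^sup>+\<nu>. ennreal (normal_density 0 \<sigma> \<nu> * \<bar>\<nu>\<bar>) \<partial>lborel)"
    by (subst nn_integral_density) (auto simp: ennreal_mult)
  also have "\<dots> = ennreal (\<sigma> * sqrt (2 / pi))"
    using has_bochner_integral_integral_eq[OF *] *
    by (subst nn_integral_eq_integral) (auto intro: integrable.intros)
  also have "\<dots> \<le> ennreal \<sigma>"
    using assms pi_ge_two by (intro ennreal_leI) (simp add: mult_left_le)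
  finally show ?thesis .
qed

lemma UL_at_multi_source:
  assumes m: "2 \<le> m" and D: "is_dataset m D" and \<epsilon>: "0 < \<epsilon>" "\<epsilon> \<le> 1" and \<delta>: "0 < \<delta>" "\<delta> < 1.25"
    and \<gamma>: "\<gamma> = sqrt (2 * ln (1.25 / \<delta>)) / \<epsilon>" and L: "0 \<le> ln (real m / \<tau>)"
    and tot: "\<And>a. num (nths D S) a = 0 \<Longrightarrow> total (nths D S) a = 0"
    and src: "\<And>a. 0 < num (nths D S) a \<Longrightarrow> a < m \<and> num (nths D S) a < num D a \<and>
      real (num (nths D S) a) \<le> real (num D a) - sqrt (real (num D a) * ln (real m / \<tau>) / 2)"
  shows "UL_at m \<epsilon> \<delta> (multi_source m \<tau> \<gamma>) D S"
proof (cases "\<delta> < 1")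
  case False
  then have "measure_pmf.prob p A \<le> exp \<epsilon> * measure_pmf.prob q A + \<delta>" for p q :: "nat pmf" and A
    using measure_pmf.prob_le_1[of p A] by (smt (verit) exp_ge_zero measure_nonneg mult_nonneg_nonneg)
  then show ?thesis
    by (simp add: UL_at_def)
next
  case True
  define k b F where "k = num (nths D S)" and "b = argmax m (lcb m \<tau> D)"
    and "F = lcb m \<tau> (nths D (- S))"
  have act: "actual_output (multi_source m \<tau> \<gamma>) D S
     = ms_select m \<tau> \<gamma> (num D) k b
         (if b \<in> sources m k \<and> \<gamma> < threshold m \<tau> (num D) k then F(b := lcb m \<tau> D b) else F)"
    unfolding k_def b_def F_def by (rule actual_output_multi_source) (use tot src in auto)
  have ref: "reference_output (multi_source m \<tau> \<gamma>) D S = ms_select m \<tau> \<gamma> (num D) k b F"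
    unfolding k_def b_def F_def by (rule reference_output_multi_source)
  show ?thesis
  proof (cases "b \<in> sources m k \<and> \<gamma> < threshold m \<tau> (num D) k")
    case noise: True
    then have k: "0 < k b" "k b < num D b"
      "real (k b) \<le> real (num D b) - sqrt (real (num D b) * ln (real m / \<tau>) / 2)"
      using src[of b] by (auto simp: sources_def k_def)
    define \<sigma> where "\<sigma> = 3 * real (k b) / (2 * real (num D b)) * \<gamma>"
    have "0 < \<gamma>"
      unfolding \<gamma> using \<epsilon> \<delta> by simp
    then have "0 < \<sigma>"
      using k by (simp add: \<sigma>_def)
    have "\<bar>lcb m \<tau> D b - F b\<bar> \<le> 3 * real (k b) / (2 * real (num D b))"
      unfolding F_def k_def using D L k by (intro lcb_sensitivity) (auto simp: k_def)
    then have h: "\<bar>lcb m \<tau> D b - F b\<bar> * (sqrt (2 * ln (1.25 / \<delta>)) / \<epsilon>) \<le> \<sigma>"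
      unfolding \<sigma>_def \<gamma>[symmetric] using \<open>0 < \<gamma>\<close> by (intro mult_right_mono) auto
    then have h': "\<bar>F b - lcb m \<tau> D b\<bar> * (sqrt (2 * ln (1.25 / \<delta>)) / \<epsilon>) \<le> \<sigma>"
      by (simp add: abs_minus_commute)
    have "actual_output (multi_source m \<tau> \<gamma>) D S = noisy_argmax m (F(b := lcb m \<tau> D b)) b \<sigma>"
      unfolding act using noise by (simp add: ms_select_def \<sigma>_def)
    \<comment> \<open>Writing the unchanged vector as an update at \<open>b\<close> exhibits both
      runs as the same mechanism with different centres, so the comparison can be applied in either
      direction.\<close>
    moreover have "reference_output (multi_source m \<tau> \<gamma>) D S = noisy_argmax m (F(b := F b)) b \<sigma>"
      unfolding ref using noise by (simp add: ms_select_def \<sigma>_def)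
    ultimately show ?thesis
      unfolding UL_at_def using m True \<epsilon> \<delta>(1) \<open>0 < \<sigma>\<close> h h'
      by (auto intro!: noisy_argmax_indistinguishable simp del: fun_upd_triv)
  next
    case False
    have "x \<le> exp \<epsilon> * x + \<delta>" if "0 \<le> x" for x
      using that \<epsilon> \<delta> mult_right_mono[of 1 "exp \<epsilon>" x] by simp
    then show ?thesis
      using False by (auto simp: UL_at_def act ref)
  qed
qed

section \<open>Concentration of the lower confidence bounds\<close>

text \<open>The product runs over all data points, whereas the sum takes only those of one arm: the
  coordinates are independent, so any subfamily is too, and only that subfamily needs the common
  mean.\<close>

lemma hoeffding_PiM:
  fixes Q :: "nat \<Rightarrow> real measure"
  assumes I: "I \<subseteq> {..<n}" "I \<noteq> {}"
    and Q: "\<And>i. i < n \<Longrightarrow> prob_space (Q i)" "\<And>i. i < n \<Longrightarrow> sets (Q i) = sets borel"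
      "\<And>i. i < n \<Longrightarrow> AE x in Q i. 0 \<le> x \<and> x \<le> 1"
    and \<mu>: "\<And>i. i \<in> I \<Longrightarrow> (\<integral>x. x \<partial>Q i) = \<mu>" and t: "0 \<le> t"
  shows "measure (PiM {..<n} Q) {\<omega>\<in>space (PiM {..<n} Q). t \<le> \<bar>(\<Sum>i\<in>I. \<omega> i) - real (card I) * \<mu>\<bar>}
    \<le> 2 * exp (- 2 * t\<^sup>2 / real (card I))"
proof -
  define M where "M = PiM {..<n} Q"
  interpret M: prob_space M
    unfolding M_def by (rule prob_space_PiM) (use Q in auto)
  have rv: "(\<lambda>\<omega>. \<omega> i) \<in> borel_measurable M" if "i < n" for i
    using measurable_component_singleton[of i "{..<n}" Q] that Q(2)[OF that]
    by (simp add: M_def cong: measurable_cong_sets)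
  have distr: "distr M borel (\<lambda>\<omega>. \<omega> i) = Q i" if "i < n" for i
  proof -
    have "distr M (Q i) (\<lambda>\<omega>. \<omega> i) = Q i"
      unfolding M_def by (rule distr_PiM_component) (use Q that in auto)
    then show ?thesis
      using Q(2)[OF that] by (metis distr_cong)
  qed
  \<comment> \<open>Independence is checked on joint laws: the law of the identity map is the
    product measure itself, and its factors are the laws of the coordinates.\<close>
  have "M.indep_vars (\<lambda>_. borel) (\<lambda>i \<omega>. \<omega> i) {..<n}"
  proof (subst M.indep_vars_iff_distr_eq_PiM')
    show "{..<n} \<noteq> {}"
      using I by auto
    have sets: "sets (PiM {..<n} (\<lambda>_. borel)) = sets M"
      unfolding M_def by (rule sets_PiM_cong) (use Q in auto)
    have "distr M (PiM {..<n} (\<lambda>_. borel)) (\<lambda>\<omega>. \<lambda>i\<in>{..<n}. \<omega> i) = distr M M (\<lambda>\<omega>. \<omega>)"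
      by (rule distr_cong) (use sets in \<open>auto simp: M_def space_PiM PiE_restrict restrict_PiE extensional_restrict\<close>)
    also have "\<dots> = M"
      by (rule distr_id)
    also have "\<dots> = PiM {..<n} (\<lambda>i. distr M borel (\<lambda>\<omega>. \<omega> i))"
      unfolding M_def[of] by (rule PiM_cong) (use distr in \<open>auto simp: M_def\<close>)
    finally show "distr M (PiM {..<n} (\<lambda>_. borel)) (\<lambda>\<omega>. \<lambda>i\<in>{..<n}. \<omega> i)
      = PiM {..<n} (\<lambda>i. distr M borel (\<lambda>\<omega>. \<omega> i))" .
  qed (use rv in auto)
  then have indep: "M.indep_vars (\<lambda>_. borel) (\<lambda>i \<omega>. \<omega> i) I"
    using I(1) by (rule M.indep_vars_subset)
  have exp: "M.expectation (\<lambda>\<omega>. \<omega> i) = \<mu>" if "i \<in> I" for i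
  proof -
    have i: "i < n"
      using that I by auto
    have "(\<integral>x. x \<partial>distr M borel (\<lambda>\<omega>. \<omega> i)) = M.expectation (\<lambda>\<omega>. \<omega> i)"
      using rv[OF i] by (subst integral_distr) auto
    then show ?thesis
      using \<mu>[OF that] distr[OF i] by simp
  qed
  have fin: "finite I"
    using I finite_subset by auto
  have "card I > 0"
    using fin I by (simp add: card_gt_0_iff)
  interpret H: Hoeffding_ineq M I "\<lambda>i \<omega>. \<omega> i" "\<lambda>_. 0" "\<lambda>_. 1" "real (card I) * \<mu>"
  proof unfold_locales
    show "AE \<omega> in M. \<omega> i \<in> {0..1}" if "i \<in> I" for i
      unfolding M_def using I that Q by (intro AE_PiM_component) auto
    show "real (card I) * \<mu> \<equiv> \<Sum>i\<in>I. M.expectation (\<lambda>\<omega>. \<omega> i)"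
      using exp by (simp add: atomize_eq)
  qed (use fin indep in auto)
  show ?thesis
    using H.Hoeffding_ineq_abs_ge[OF t] \<open>card I > 0\<close> by (simp add: M_def)
qed

section \<open>Datasets with a fixed arm sequence and random rewards\<close>

lemma
  assumes "length arms = n"
  shows length_data: "length (data arms \<omega>) = n"
    and nth_data: "i < n \<Longrightarrow> data arms \<omega> ! i = (arms ! i, \<omega> i)"
  using assms by (auto simp: data_def)

lemma map_fst_data: "map fst (data arms \<omega>) = arms"
  by (simp add: data_def)

lemma num_data: "num (data arms \<omega>) a = count_list arms a"
proof -
  have "num D a = count_list (map fst D) a" for D :: dataset
    by (induction D) (auto simp: num_def)
  then show ?thesis
    by (simp add: map_fst_data)
qed

lemma
  shows num_nths_data: "num (nths (data arms \<omega>) S) a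
      = card {i. i < length arms \<and> i \<in> S \<and> arms ! i = a}"
    and total_nths_data: "total (nths (data arms \<omega>) S) a
      = (\<Sum>i | i < length arms \<and> i \<in> S \<and> arms ! i = a. \<omega> i)"
proof -
  have *: "{i. i < length (data arms \<omega>) \<and> i \<in> S \<and> fst (data arms \<omega> ! i) = a}
      = {i. i < length arms \<and> i \<in> S \<and> arms ! i = a}"
    by (auto simp: length_data nth_data)
  show "num (nths (data arms \<omega>) S) a = card {i. i < length arms \<and> i \<in> S \<and> arms ! i = a}"
    unfolding num_nths * ..
  show "total (nths (data arms \<omega>) S) a = (\<Sum>i | i < length arms \<and> i \<in> S \<and> arms ! i = a. \<omega> i)"
    unfolding total_nths * by (rule sum.cong) (auto simp: nth_data)
qed

text \<open>Since \<open>lcb\<close> already subtracts one bonus, this says that every empirical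
  mean is within one bonus of the true mean.\<close>

definition confident :: "nat \<Rightarrow> real \<Rightarrow> (nat \<Rightarrow> real measure) \<Rightarrow> dataset \<Rightarrow> bool" where
  "confident m \<tau> R D \<longleftrightarrow>
     (\<forall>a<m. lcb m \<tau> D a \<le> mean R a \<and> mean R a \<le> lcb m \<tau> D a + 2 * bonus m \<tau> (num D a))"

lemma mean_bounds:
  assumes "prob_space (R a)" "AE x in R a. 0 \<le> x \<and> x \<le> 1" "sets (R a) = sets borel"
  shows "0 \<le> mean R a" "mean R a \<le> 1"
proof -
  interpret prob_space "R a" by fact
  show "0 \<le> mean R a"
    unfolding mean_def using assms(2) by (intro integral_nonneg_AE) auto
  have "(\<lambda>x. x) \<in> borel_measurable (R a)"
    using assms(3) by (simp cong: measurable_cong_sets)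
  then have "integrable (R a) (\<lambda>x. x)"
    using assms(2) by (intro integrable_const_bound[where B = 1]) auto
  then show "mean R a \<le> 1"
    unfolding mean_def using assms(2) integral_le_const by auto
qed

text \<open>Each arm contributes failure probability at most \<open>2 * \<tau> / m\<close>, and a
  union bound over the arms gives \<open>2 * \<tau>\<close>. A measurable set containing the
  failures is all that the later integration requires.\<close>

lemma ex_not_confident_event:
  assumes arms: "set arms \<subseteq> {..<m}" and \<tau>: "0 < \<tau>" "\<tau> \<le> real m"
    and R: "\<And>a. a < m \<Longrightarrow> prob_space (R a)" "\<And>a. a < m \<Longrightarrow> sets (R a) = sets borel"
      "\<And>a. a < m \<Longrightarrow> AE x in R a. 0 \<le> x \<and> x \<le> 1"
  defines "M \<equiv> Pi\<^sub>M {..<length arms} (\<lambda>i. R (arms ! i))"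
  shows "\<exists>B\<in>sets M. emeasure M B \<le> ennreal (2 * \<tau>) \<and>
    (\<forall>\<omega>\<in>space M - B. confident m \<tau> R (nths (data arms \<omega>) S))"
proof -
  have armsm: "arms ! i < m" if "i < length arms" for i
    using that arms nth_mem by blast
  interpret M: prob_space M
    unfolding M_def by (rule prob_space_PiM) (use R armsm in auto)
  have rv [measurable]: "(\<lambda>\<omega>. \<omega> i) \<in> borel_measurable M" if "i < length arms" for i
    using measurable_component_singleton[of i "{..<length arms}" "\<lambda>i. R (arms ! i)"] that
      R(2)[OF armsm[OF that]]
    by (simp add: M_def cong: measurable_cong_sets)
  define L where "L = ln (real m / \<tau>)"
  have "0 < m"
    using \<tau> by (cases m) auto
  have L: "0 \<le> L" "exp (- L) = \<tau> / real m"
    using \<tau> \<open>0 < m\<close> by (auto simp: L_def exp_minus)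
  define I where "I a = {i. i < length arms \<and> i \<in> S \<and> arms ! i = a}" for a
  \<comment> \<open>The sample count times the bonus: this deviation of the sum makes the Hoeffding
    exponent exactly \<open>- L\<close>, and \<open>exp (- L) = \<tau> / m\<close>.\<close>
  define t where "t a = real (card (I a)) * sqrt (L / (2 * real (card (I a))))" for a
  define B where "B a = (if I a = {} then {} else
    {\<omega>\<in>space M. t a \<le> \<bar>(\<Sum>i\<in>I a. \<omega> i) - real (card (I a)) * mean R a\<bar>})" for a
  have finI: "finite (I a)" for a
    by (auto simp: I_def)
  have B_sets: "B a \<in> sets M" for a
  proof -
    have [measurable]: "(\<lambda>\<omega>. \<Sum>i\<in>I a. \<omega> i) \<in> borel_measurable M"
      by (rule borel_measurable_sum) (auto simp: I_def rv)
    show ?thesis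
      unfolding B_def by simp
  qed
  have B_prob: "M.prob (B a) \<le> 2 * \<tau> / real m" if "a < m" for a
  proof (cases "I a = {}")
    case False
    then have c: "0 < card (I a)"
      using finI by (simp add: card_gt_0_iff)
    have "(t a)\<^sup>2 = (real (card (I a)))\<^sup>2 * (L / (2 * real (card (I a))))"
      using L by (simp add: t_def power_mult_distrib)
    also have "\<dots> = real (card (I a)) * L / 2"
      using c by (simp add: power2_eq_square)
    finally have "2 * (t a)\<^sup>2 = real (card (I a)) * L"
      by simp
    then have t: "- 2 * (t a)\<^sup>2 / real (card (I a)) = - L"
      using c by (simp only: minus_mult_left[symmetric] minus_divide_left[symmetric]) simp
    have "M.prob (B a) \<le> 2 * exp (- 2 * (t a)\<^sup>2 / real (card (I a)))"
      unfolding B_def if_not_P[OF False] M_def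
    proof (rule hoeffding_PiM)
      show "0 \<le> t a"
        using L by (simp add: t_def)
    qed (use False armsm R in \<open>auto simp: I_def mean_def\<close>)
    then show ?thesis
      unfolding t L by simp
  qed (use \<tau> in \<open>auto simp: B_def\<close>)
  have "M.prob (\<Union>a\<in>{..<m}. B a) \<le> (\<Sum>a\<in>{..<m}. M.prob (B a))"
    using B_sets by (intro M.finite_measure_subadditive_finite) auto
  also have "\<dots> \<le> (\<Sum>a\<in>{..<m}. 2 * \<tau> / real m)"
    using B_prob by (intro sum_mono) auto
  also have "\<dots> = 2 * \<tau>"
    using \<open>0 < m\<close> by simp
  finally have "emeasure M (\<Union>a\<in>{..<m}. B a) \<le> ennreal (2 * \<tau>)"
    by (simp add: M.emeasure_eq_measure ennreal_leI)
  moreover have "confident m \<tau> R (nths (data arms \<omega>) S)" if \<omega>: "\<omega> \<in> space M - (\<Union>a\<in>{..<m}. B a)" for \<omega>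
    unfolding confident_def
  proof (intro allI impI)
    fix a assume a: "a < m"
    have n: "num (nths (data arms \<omega>) S) a = card (I a)"
      "total (nths (data arms \<omega>) S) a = (\<Sum>i\<in>I a. \<omega> i)"
      by (simp_all add: num_nths_data total_nths_data I_def)
    show "lcb m \<tau> (nths (data arms \<omega>) S) a \<le> mean R a \<and>
      mean R a \<le> lcb m \<tau> (nths (data arms \<omega>) S) a + 2 * bonus m \<tau> (num (nths (data arms \<omega>) S) a)"
    proof (cases "I a = {}")
      \<comment> \<open>An arm without data has bound \<open>0 - 1\<close> and bonus 1, and its mean
        lies in [0, 1]; the default values make confidence automatic.\<close>
      case True
      then show ?thesis
        using mean_bounds[of R a] R[OF a] by (simp add: lcb_def emp_mean_def bonus_def n)
    next
      case False
      then have c: "0 < real (card (I a))"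
        using finI by (simp add: card_gt_0_iff)
      define s where "s = sqrt (L / (2 * real (card (I a))))"
      have "\<bar>(\<Sum>i\<in>I a. \<omega> i) - real (card (I a)) * mean R a\<bar> < real (card (I a)) * s"
        using \<omega> a False by (auto simp: B_def t_def s_def not_le)
      then have "\<bar>(\<Sum>i\<in>I a. \<omega> i) / real (card (I a)) - mean R a\<bar> < s"
        using c by (auto simp: abs_less_iff field_simps)
      then show ?thesis
        using c by (simp add: lcb_def emp_mean_def bonus_def n L_def[symmetric] s_def[symmetric] abs_less_iff)
    qed
  qed
  ultimately show ?thesis
    using B_sets by (intro bexI[of _ "\<Union>a\<in>{..<m}. B a"]) auto
qed

text \<open>Regret never exceeds 1, so the failure events of the full and the retained data cost
  \<open>2 * \<tau>\<close> each. The regret is dominated pointwise by a constant plus two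
  indicators, and only this dominating function has to be integrated explicitly.\<close>

lemma expected_subopt_le:
  assumes arms: "set arms \<subseteq> {..<m}" and \<tau>: "0 < \<tau>" "\<tau> \<le> real m" and R: "bandit_instance m Nv Nstar R"
    and P: "\<And>\<omega>. set_pmf (actual_output P (data arms \<omega>) S) \<subseteq> {..<m}"
    and c: "0 \<le> c" "\<And>\<omega>. confident m \<tau> R (data arms \<omega>) \<Longrightarrow> confident m \<tau> R (nths (data arms \<omega>) (- S)) \<Longrightarrow>
      (\<integral>\<^sup>+a. ennreal (best_mean m R - mean R a) \<partial>measure_pmf (actual_output P (data arms \<omega>) S)) \<le> ennreal c"
  shows "expected_subopt m arms R S P \<le> ennreal (c + 4 * \<tau>)"
proof -
  define M where "M = Pi\<^sub>M {..<length arms} (\<lambda>i. R (arms ! i))"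
  have R': "prob_space (R a)" "sets (R a) = sets borel" "AE x in R a. 0 \<le> x \<and> x \<le> 1" if "a < m" for a
    using R that by (auto simp: bandit_instance_def)
  have armsm: "arms ! i < m" if "i < length arms" for i
    using that arms nth_mem by blast
  interpret M: prob_space M
    unfolding M_def by (rule prob_space_PiM) (use R' armsm in auto)
  obtain B where B: "B \<in> sets M" "emeasure M B \<le> ennreal (2 * \<tau>)"
    "\<And>\<omega>. \<omega> \<in> space M - B \<Longrightarrow> confident m \<tau> R (data arms \<omega>)"
    using ex_not_confident_event[where R = R and S = UNIV, OF arms \<tau> R'] by (auto simp: M_def nths_UNIV)
  obtain B' where B': "B' \<in> sets M" "emeasure M B' \<le> ennreal (2 * \<tau>)"
    "\<And>\<omega>. \<omega> \<in> space M - B' \<Longrightarrow> confident m \<tau> R (nths (data arms \<omega>) (- S))"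
    using ex_not_confident_event[where R = R and S = "- S", OF arms \<tau> R'] by (auto simp: M_def)
  define g where "g \<omega> = (\<integral>\<^sup>+a. ennreal (best_mean m R - mean R a)
    \<partial>measure_pmf (actual_output P (data arms \<omega>) S))" for \<omega>
  obtain a0 where a0: "a0 < m" "mean R a0 = best_mean m R"
    using R by (auto simp: bandit_instance_def)
  have "best_mean m R - mean R a \<le> 1" if "a < m" for a
    using mean_bounds[of R a0] mean_bounds[of R a] R' that a0 by force
  then have g1: "g \<omega> \<le> 1" for \<omega>
  proof -
    have "g \<omega> \<le> (\<integral>\<^sup>+a. 1 \<partial>measure_pmf (actual_output P (data arms \<omega>) S))"
      unfolding g_def using P[of \<omega>] \<open>\<And>a. a < m \<Longrightarrow> best_mean m R - mean R a \<le> 1\<close>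
      by (intro nn_integral_mono_AE) (auto simp: AE_measure_pmf_iff)
    then show ?thesis
      by simp
  qed
  have "expected_subopt m arms R S P = (\<integral>\<^sup>+\<omega>. g \<omega> \<partial>M)"
    by (simp add: expected_subopt_def g_def M_def)
  also have "\<dots> \<le> (\<integral>\<^sup>+\<omega>. ennreal c + (indicator B \<omega> + indicator B' \<omega>) \<partial>M)"
  proof (intro nn_integral_mono)
    fix \<omega> assume \<omega>: "\<omega> \<in> space M"
    show "g \<omega> \<le> ennreal c + (indicator B \<omega> + indicator B' \<omega>)"
    proof (cases "\<omega> \<in> B \<union> B'")
      case True
      then have "(1::ennreal) \<le> indicator B \<omega> + indicator B' \<omega>"
        by (auto simp: indicator_def)
      then show ?thesis
        using g1[of \<omega>] by (meson add_increasing order_trans zero_le)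
    next
      case False
      then have "g \<omega> \<le> ennreal c"
        unfolding g_def using B(3) B'(3) \<omega> by (intro c) auto
      then show ?thesis
        using False by simp
    qed
  qed
  also have "\<dots> = ennreal c + (emeasure M B + emeasure M B')"
    using B(1) B'(1) by (simp add: nn_integral_add M.emeasure_space_1)
  also have "\<dots> \<le> ennreal c + (ennreal (2 * \<tau>) + ennreal (2 * \<tau>))"
    using B(2) B'(2) by (intro add_mono) auto
  also have "\<dots> = ennreal (c + 4 * \<tau>)"
    using c(1) \<tau> by (simp flip: ennreal_plus)
  finally show ?thesis .
qed


section \<open>Sub-optimality\<close>

text \<open>Pessimism: the chosen arm's bound underestimates its mean and exceeds the bound of
  \<open>a\<close>. Hence only the uncertainty of the comparison arm \<open>a\<close> is paid,
  however poorly the chosen arm is sampled.\<close>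

lemma regret_argmax_lcb:
  assumes "confident m \<tau> R D" "a < m"
  shows "mean R a - mean R (argmax m (lcb m \<tau> D)) \<le> 2 * bonus m \<tau> (num D a)"
proof -
  have "0 < m"
    using assms(2) by auto
  then have "argmax m (lcb m \<tau> D) < m" "lcb m \<tau> D a \<le> lcb m \<tau> D (argmax m (lcb m \<tau> D))"
    using assms(2) by (auto intro: argmax_less argmax_ge)
  then show ?thesis
    using assms unfolding confident_def by (smt (verit, ccfv_threshold))
qed

text \<open>An arm that overtakes the learned arm \<open>b\<close> has a lower confidence bound, hence a mean, above the
  perturbed value of \<open>b\<close>; so the bonus on the reduced data does not enter.\<close>

lemma regret_noisy_argmax:
  assumes "confident m \<tau> R D" "confident m \<tau> R D'" "a < m" and b: "b = argmax m (lcb m \<tau> D)"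
  shows "mean R a - mean R (argmax m ((lcb m \<tau> D')(b := lcb m \<tau> D b + \<nu>)))
    \<le> 2 * bonus m \<tau> (num D a) + \<bar>\<nu>\<bar>"
proof -
  define F where "F = (lcb m \<tau> D')(b := lcb m \<tau> D b + \<nu>)"
  have m: "0 < m"
    using assms(3) by auto
  have bm: "b < m" "lcb m \<tau> D a \<le> lcb m \<tau> D b"
    unfolding b using m assms(3) by (auto intro: argmax_less argmax_ge)
  have F: "argmax m F < m" "F b \<le> F (argmax m F)"
    using m bm by (auto intro: argmax_less argmax_ge)
  have "mean R a \<le> lcb m \<tau> D b + 2 * bonus m \<tau> (num D a)"
    using assms(1,3) bm unfolding confident_def by fastforce
  moreover have "lcb m \<tau> D b - \<bar>\<nu>\<bar> \<le> mean R (argmax m F)"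
  proof (cases "argmax m F = b")
    case True
    then show ?thesis
      using assms(1) bm unfolding confident_def by fastforce
  next
    case False
    then have "lcb m \<tau> D b + \<nu> \<le> lcb m \<tau> D' (argmax m F)"
      using F(2) by (simp add: F_def)
    moreover have "lcb m \<tau> D' (argmax m F) \<le> mean R (argmax m F)"
      using assms(2) F(1) unfolding confident_def by auto
    ultimately show ?thesis by linarith
  qed
  ultimately show ?thesis
    unfolding F_def by linarith
qed

text \<open>At a source the noise scale is positive, which is what makes \<open>noisy_argmax\<close>
  a genuine law on the arms.\<close>

lemma set_pmf_multi_source:
  assumes "0 < m" "0 < \<gamma>"
    and tot: "\<And>a. num (nths D S) a = 0 \<Longrightarrow> total (nths D S) a = 0"
    and src: "\<And>a. 0 < num (nths D S) a \<Longrightarrow> a < m \<and> num (nths D S) a < num D a"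
  shows "set_pmf (actual_output (multi_source m \<tau> \<gamma>) D S) \<subseteq> {..<m}"
proof -
  have "0 < 3 * real (num (nths D S) b) / (2 * real (num D b)) * \<gamma>"
    if "b \<in> sources m (num (nths D S))" for b
    using that src[of b] assms(2) by (auto simp: sources_def)
  then have "set_pmf (ms_select m \<tau> \<gamma> (num D) (num (nths D S)) b F) \<subseteq> {..<m}" for b F
    using set_pmf_noisy_argmax[OF assms(1)] argmax_less[OF assms(1)]
    by (simp add: ms_select_def)
  then show ?thesis
    by (subst actual_output_multi_source) (use tot src in auto)
qed

lemma regret_multi_source_below_threshold:
  assumes a: "a < m" and \<gamma>: "0 < \<gamma>"
    and conf: "confident m \<tau> R D" "confident m \<tau> R (nths D (- S))"
    and tot: "\<And>a. num (nths D S) a = 0 \<Longrightarrow> total (nths D S) a = 0"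
    and src: "\<And>a. 0 < num (nths D S) a \<Longrightarrow> a < m \<and> num (nths D S) a < num D a"
    and thr: "\<gamma> < threshold m \<tau> (num D) (num (nths D S))"
    and s: "0 \<le> s" "\<And>a. a \<in> sources m (num (nths D S)) \<Longrightarrow> 3 * real (num (nths D S) a) / (2 * real (num D a)) * \<gamma> \<le> s"
    and bon: "0 \<le> bonus m \<tau> (num D a)"
  shows "(\<integral>\<^sup>+x. ennreal (mean R a - mean R x) \<partial>measure_pmf (actual_output (multi_source m \<tau> \<gamma>) D S))
    \<le> ennreal (2 * bonus m \<tau> (num D a) + s)"
proof -
  define k b F where "k = num (nths D S)" and "b = argmax m (lcb m \<tau> D)"
    and "F = lcb m \<tau> (nths D (- S))"
  have m: "0 < m"
    using a by auto
  have act: "actual_output (multi_source m \<tau> \<gamma>) D S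
     = ms_select m \<tau> \<gamma> (num D) k b
         (if b \<in> sources m k \<and> \<gamma> < threshold m \<tau> (num D) k then F(b := lcb m \<tau> D b) else F)"
    unfolding k_def b_def F_def by (rule actual_output_multi_source) (use tot src in auto)
  have reg: "mean R a - mean R (argmax m (F(b := lcb m \<tau> D b + \<nu>))) \<le> 2 * bonus m \<tau> (num D a) + \<bar>\<nu>\<bar>" for \<nu>
    unfolding F_def using conf a b_def by (rule regret_noisy_argmax)
  show ?thesis
  proof (cases "b \<in> sources m k")
    case True
    define \<sigma> where "\<sigma> = 3 * real (k b) / (2 * real (num D b)) * \<gamma>"
    have \<sigma>: "0 < \<sigma>" "\<sigma> \<le> s"
      using True src[of b] \<gamma> s(2)[of b] by (auto simp: \<sigma>_def sources_def k_def)
    interpret N: prob_space "density lborel (normal_density 0 \<sigma>)"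
      using \<sigma>(1) by (rule prob_space_normal_density)
    have meas: "(\<lambda>\<nu>. argmax m (F(b := lcb m \<tau> D b + \<nu>))) \<in> density lborel (normal_density 0 \<sigma>) \<rightarrow>\<^sub>M count_space UNIV"
      using m by (intro measurable_argmax) (auto simp: fun_upd_def)
    have "actual_output (multi_source m \<tau> \<gamma>) D S = noisy_argmax m (F(b := lcb m \<tau> D b)) b \<sigma>"
      unfolding act using True thr by (simp add: ms_select_def \<sigma>_def k_def)
    then have "(\<integral>\<^sup>+x. ennreal (mean R a - mean R x) \<partial>measure_pmf (actual_output (multi_source m \<tau> \<gamma>) D S))
      = (\<integral>\<^sup>+\<nu>. ennreal (mean R a - mean R (argmax m (F(b := lcb m \<tau> D b + \<nu>)))) \<partial>density lborel (normal_density 0 \<sigma>))"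
      using meas by (simp add: measure_pmf_noisy_argmax[OF m \<sigma>(1)] nn_integral_distr)
    also have "\<dots> \<le> (\<integral>\<^sup>+\<nu>. ennreal (2 * bonus m \<tau> (num D a)) + ennreal \<bar>\<nu>\<bar> \<partial>density lborel (normal_density 0 \<sigma>))"
      using reg bon by (intro nn_integral_mono) (simp flip: ennreal_plus add: ennreal_leI)
    also have "\<dots> \<le> ennreal (2 * bonus m \<tau> (num D a)) + ennreal \<sigma>"
      using normal_abs_moment[OF \<sigma>(1)]
      by (subst nn_integral_add) (auto simp: N.emeasure_space_1[simplified] intro!: add_left_mono)
    also have "\<dots> \<le> ennreal (2 * bonus m \<tau> (num D a) + s)"
      using \<sigma> bon by (simp flip: ennreal_plus add: ennreal_leI)
    finally show ?thesis .
  next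
    case False
    have "b < m"
      unfolding b_def using m by (rule argmax_less)
    then have "k b = 0"
      using False by (auto simp: sources_def)
    then have "F b = lcb m \<tau> D b"
      unfolding F_def k_def using tot by (intro lcb_nths_compl_unaffected) auto
    \<comment> \<open>If the learned arm is not a source, no noise is drawn and its entry is
      unaffected by deletion; the output is the case \<open>\<nu> = 0\<close> of the noisy
      bound.\<close>
    then have "F(b := lcb m \<tau> D b + 0) = F"
      by auto
    moreover have "actual_output (multi_source m \<tau> \<gamma>) D S = return_pmf (argmax m F)"
      unfolding act using False by (simp add: ms_select_def)
    ultimately show ?thesis
      using reg[of 0] s(1) by (simp add: ennreal_leI)
  qed
qed

lemma regret_multi_source_above_threshold:
  assumes a: "a < m" and conf: "confident m \<tau> R (nths D (- S))"
    and tot: "\<And>a. num (nths D S) a = 0 \<Longrightarrow> total (nths D S) a = 0"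
    and src: "\<And>a. 0 < num (nths D S) a \<Longrightarrow> a < m \<and> num (nths D S) a < num D a"
    and thr: "\<not> \<gamma> < threshold m \<tau> (num D) (num (nths D S))"
  shows "(\<integral>\<^sup>+x. ennreal (mean R a - mean R x) \<partial>measure_pmf (actual_output (multi_source m \<tau> \<gamma>) D S))
    \<le> ennreal (2 * bonus m \<tau> (num (nths D (- S)) a))"
proof -
  have "actual_output (multi_source m \<tau> \<gamma>) D S = return_pmf (argmax m (lcb m \<tau> (nths D (- S))))"
    by (subst actual_output_multi_source) (use tot src thr in \<open>auto simp: ms_select_def\<close>)
  then show ?thesis
    using regret_argmax_lcb[OF conf a] by (simp add: ennreal_leI)
qed


section \<open>A pair that returns the learned arm\<close>

text \<open>The reference run may see the arm learned from the full dataset, so both runs can return this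
  arm; the outputs then coincide in law and the pair is unlearning for all \<open>\<epsilon>\<close> and \<open>\<delta>\<close>, including
  \<open>\<epsilon> > 1\<close>, where the Gaussian mechanism need not be. It has the sub-optimality of the learner.\<close>

definition return_learned :: "nat \<Rightarrow> real \<Rightarrow> (dataset \<times> info option) alg_pair" where
  "return_learned m \<tau> =
     \<lparr>learn = lcb_learner m \<tau>, stat = Pair,
      unlearn = (\<lambda>q a s. return_pmf (case (q, snd s) of
        (None, Some (b, _)) \<Rightarrow> if b < m then b else a | _ \<Rightarrow> a))\<rparr>"

lemma actual_output_return_learned:
  "actual_output (return_learned m \<tau>) D S = return_pmf (argmax m (lcb m \<tau> D))"
  by (simp add: actual_output_def return_learned_def lcb_learner_def bind_return_pmf)

lemma reference_output_return_learned:
  "0 < m \<Longrightarrow> reference_output (return_learned m \<tau>) D S = return_pmf (argmax m (lcb m \<tau> D))"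
  by (simp add: reference_output_def return_learned_def lcb_learner_def bind_return_pmf argmax_less)

lemma UL_return_learned:
  assumes "0 < m" "0 \<le> \<epsilon>" "0 \<le> \<delta>"
  shows "UL m \<epsilon> \<delta> (return_learned m \<tau>)"
proof -
  have "x \<le> exp \<epsilon> * x + \<delta>" if "0 \<le> x" for x
    using that assms mult_right_mono[of 1 "exp \<epsilon>" x] by simp
  then show ?thesis
    by (simp add: UL_def UL_at_def actual_output_return_learned
        reference_output_return_learned[OF assms(1)] del: measure_return_pmf)
qed

lemma measurable_lcb_data:
  "(\<lambda>\<omega>. lcb m \<tau> (data arms \<omega>) a) \<in> borel_measurable (Pi\<^sub>M {..<length arms} (\<lambda>_. borel))"
proof -
  have [measurable]: "(\<lambda>\<omega>. \<Sum>i | i < length arms \<and> arms ! i = a. \<omega> i :: real)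
      \<in> borel_measurable (Pi\<^sub>M {..<length arms} (\<lambda>_. borel))"
    by (intro borel_measurable_sum measurable_component_singleton) auto
  have total: "total (data arms \<omega>) a = (\<Sum>i | i < length arms \<and> arms ! i = a. \<omega> i)" for \<omega>
    using total_nths_data[of arms \<omega> UNIV a] by (simp add: nths_UNIV)
  show ?thesis
    unfolding lcb_def emp_mean_def num_data total by simp
qed

text \<open>The guard \<open>b < m\<close> in \<open>return_learned\<close> serves this lemma:
  \<open>unlearn\<close> has to return an arm for every statistic, also one whose stored
  \<open>b\<close> is not an arm.\<close>

lemma admissible_return_learned:
  assumes "0 < m"
  shows "admissible m (return_learned m \<tau>)"
  unfolding admissible_def
proof (intro conjI allI impI)
  show "set_pmf (learn (return_learned m \<tau>) D) \<subseteq> {..<m}" for D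
    using argmax_less[OF assms] by (simp add: return_learned_def lcb_learner_def)
  show "set_pmf (unlearn (return_learned m \<tau>) q a s) \<subseteq> {..<m}" if "a < m" for q a s
    using that by (auto simp: return_learned_def split: option.splits)
  show "(\<lambda>\<omega>. pmf (actual_output (return_learned m \<tau>) (data arms \<omega>) S) a)
      \<in> borel_measurable (Pi\<^sub>M {..<length arms} (\<lambda>_. borel))" for arms S a
  proof -
    have "(\<lambda>\<omega>. argmax m (lcb m \<tau> (data arms \<omega>)))
        \<in> Pi\<^sub>M {..<length arms} (\<lambda>_. borel) \<rightarrow>\<^sub>M count_space UNIV"
      using assms measurable_lcb_data by (rule measurable_argmax)
    then show ?thesis
      unfolding actual_output_return_learned by (rule measurable_compose) simp
  qed
qed


section \<open>Fixed-sample bounds\<close>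

locale request_model =
  fixes m :: nat and Nv :: "nat \<Rightarrow> nat" and Nstar :: real and l :: nat and u k :: "nat \<Rightarrow> nat"
    and N Nmin kmax :: nat and \<tau> :: real
  assumes m: "2 \<le> m" and N: "N = (\<Sum>a<m. Nv a)" and Nstar: "0 < Nstar" and l: "1 \<le> l"
    and inj: "inj_on u {..<l}" and u: "\<forall>i<l. u i < m" and k: "\<forall>i<l. 1 \<le> k i"
    and Nmin: "Nmin = Min ((\<lambda>i. Nv (u i)) ` {..<l})" and kmax: "kmax = Max (k ` {..<l})"
    and \<tau>: "\<tau> = 1 / real N" and kmax_less: "kmax < Nmin"
begin

lemma Nmin_le: "i < l \<Longrightarrow> Nmin \<le> Nv (u i)"
  unfolding Nmin by (intro Min_le) auto

lemma le_kmax: "i < l \<Longrightarrow> k i \<le> kmax"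
  unfolding kmax by (intro Max_ge) auto

lemma Nv_le: "a < m \<Longrightarrow> Nv a \<le> N"
  unfolding N by (intro member_le_sum) auto

lemma two_le_N: "2 \<le> N"
proof -
  have "0 < l"
    using l by simp
  then have "1 \<le> k 0" "k 0 \<le> kmax" "Nmin \<le> Nv (u 0)" "Nv (u 0) \<le> N"
    using k u le_kmax Nmin_le Nv_le by auto
  with kmax_less show ?thesis
    by linarith
qed

lemma tau_bounds: "0 < \<tau>" "\<tau> \<le> real m"
proof -
  show "0 < \<tau>"
    using two_le_N by (simp add: \<tau>)
  have "1 / real N \<le> 1"
    using two_le_N by simp
  then show "\<tau> \<le> real m"
    using m by (simp add: \<tau>)
qed

lemma ln_eq: "ln (real m / \<tau>) = ln (real N * real m)"
  by (simp add: \<tau> mult.commute)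

text \<open>The product is at least 4, which exceeds \<open>exp 1\<close>. The bound keeps the
  square roots nonnegative and lets \<open>\<tau>\<close> be absorbed into them.\<close>

lemma ln_ge_1: "1 \<le> ln (real N * real m)"
proof -
  have "exp 1 \<le> (2 * 2 :: real)"
    using exp_le by simp
  also have "\<dots> \<le> real N * real m"
    using two_le_N m by (intro mult_mono) auto
  finally show ?thesis
    using two_le_N m by (subst ln_ge_iff) auto
qed

lemma bonus_nonneg: "0 \<le> bonus m \<tau> n"
  using ln_ge_1 by (simp add: bonus_def ln_eq)

text \<open>Positivity of \<open>x\<close> excludes the default value of \<open>bonus\<close> at
  \<open>n = 0\<close>; the factor 2 in the denominator is given away.\<close>

lemma bonus_le:
  assumes "0 < x" "x \<le> real n"
  shows "bonus m \<tau> n \<le> sqrt (ln (real N * real m) / x)"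
proof -
  have "bonus m \<tau> n = sqrt (ln (real N * real m) / (2 * real n))"
    using assms by (auto simp: bonus_def ln_eq)
  also have "\<dots> \<le> sqrt (ln (real N * real m) / x)"
    using assms ln_ge_1 by (intro real_sqrt_le_mono divide_left_mono) auto
  finally show ?thesis .
qed

text \<open>The failure probability is absorbed as \<open>1 / N \<le> sqrt (1 / N)\<close>, then by
  \<open>Nstar \<le> Nv a \<le> N\<close> and the logarithm being at least 1.\<close>

lemma bandit_instance_best:
  assumes "bandit_instance m Nv Nstar R"
  obtains a where "a < m" "mean R a = best_mean m R" "Nstar \<le> real (Nv a)"
    "\<tau> \<le> sqrt (ln (real N * real m) / Nstar)"
proof -
  obtain a where a: "a < m" "mean R a = best_mean m R" "Nstar \<le> real (Nv a)"
    using assms by (auto simp: bandit_instance_def)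
  have "Nstar \<le> real N"
    using a Nv_le[of a] by linarith
  have "\<tau> \<le> sqrt (1 / real N)"
  proof (rule real_le_rsqrt)
    have "1 / real N * (1 / real N) \<le> 1 * (1 / real N)"
      using two_le_N by (intro mult_right_mono) auto
    then show "\<tau>\<^sup>2 \<le> 1 / real N"
      by (simp add: \<tau> power2_eq_square)
  qed
  also have "\<dots> \<le> sqrt (ln (real N * real m) / Nstar)"
    using \<open>Nstar \<le> real N\<close> Nstar ln_ge_1 by (intro real_sqrt_le_mono frac_le) auto
  finally show ?thesis
    using a by (intro that[of a])
qed

lemma request_data:
  assumes "\<forall>a<m. num D a = Nv a" and req: "is_request l u k (map fst D) S"
  shows "num (nths D S) a = 0 \<Longrightarrow> total (nths D S) a = 0"
    and "0 < num (nths D S) a \<Longrightarrow> a < m \<and> num (nths D S) a < num D a"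
    and "a \<in> sources m (num (nths D S)) \<Longrightarrow> num (nths D S) a \<le> kmax \<and> Nmin \<le> num D a"
proof -
  have *: "a < m \<and> 0 < num (nths D S) a \<and> num (nths D S) a \<le> kmax \<and> Nmin \<le> num D a"
    if "a \<in> u ` {..<l}"
    using that u k assms(1) num_request[OF req inj] le_kmax Nmin_le
    by (auto simp: Suc_le_eq)
  show "total (nths D S) a = 0" if "num (nths D S) a = 0"
    using * that total_request_other[OF req inj, of a] by auto
  show "a < m \<and> num (nths D S) a < num D a" if "0 < num (nths D S) a"
    using * that num_request_other[OF req inj, of a] kmax_less by fastforce
  show "num (nths D S) a \<le> kmax \<and> Nmin \<le> num D a" if "a \<in> sources m (num (nths D S))"
    using * that unfolding sources_request[OF req inj u k] by auto
qed

lemma threshold_data: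
  assumes "\<forall>a<m. num D a = Nv a" and req: "is_request l u k (map fst D) S"
  shows "threshold m \<tau> (num D) (num (nths D S))
    = 4 / 3 * sqrt (pi * ln (real N * real m) / (real Nmin - real kmax))"
  using threshold_request[OF req inj u k assms(1), of \<tau>] unfolding Nmin kmax ln_eq .

lemma UL_at_request:
  assumes "is_dataset m D" "\<forall>a<m. num D a = Nv a" and req: "is_request l u k (map fst D) S"
    and "0 < \<epsilon>" "\<epsilon> \<le> 1" "0 < \<delta>" "\<delta> < 1.25"
    and cond: "\<forall>i<l. real (k i) \<le> real (Nv (u i)) - sqrt (real (Nv (u i)) * ln (real m / \<tau>) / 2)"
  shows "UL_at m \<epsilon> \<delta> (multi_source m \<tau> (sqrt (2 * ln (1.25 / \<delta>)) / \<epsilon>)) D S"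
proof (rule UL_at_multi_source[OF m assms(1,4-7) refl])
  show "0 \<le> ln (real m / \<tau>)"
    using ln_ge_1 by (simp add: ln_eq)
  show "total (nths D S) a = 0" if "num (nths D S) a = 0" for a
    using that request_data(1)[OF assms(2,3)] by auto
  show "a < m \<and> num (nths D S) a < num D a \<and>
      real (num (nths D S) a) \<le> real (num D a) - sqrt (real (num D a) * ln (real m / \<tau>) / 2)"
    if "0 < num (nths D S) a" for a
  proof -
    have am: "a < m" "num (nths D S) a < num D a"
      using that request_data(2)[OF assms(2,3)] by auto
    have "a \<in> u ` {..<l}"
      using that num_request_other[OF req inj, of a] by fastforce
    then obtain i where "i < l" "a = u i"
      by auto
    then show ?thesis
      using am cond assms(2) num_request[OF req inj] by auto
  qed
qed

text \<open>Reduces the supremum to a deterministic statement: on confident data, the regret against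
  any arm with at least \<open>Nstar\<close> samples is at most \<open>c\<close>. The summand with
  factor 4 is the bound for the failure cost \<open>4 * \<tau>\<close>.\<close>

lemma worst_case_le:
  assumes P: "\<And>D S. \<forall>a<m. num D a = Nv a \<Longrightarrow> is_request l u k (map fst D) S \<Longrightarrow>
      set_pmf (actual_output P D S) \<subseteq> {..<m}"
    and c: "\<And>D S a R. \<forall>a<m. num D a = Nv a \<Longrightarrow> is_request l u k (map fst D) S \<Longrightarrow>
      confident m \<tau> R D \<Longrightarrow> confident m \<tau> R (nths D (- S)) \<Longrightarrow> a < m \<Longrightarrow> Nstar \<le> real (Nv a) \<Longrightarrow>
      (\<integral>\<^sup>+x. ennreal (mean R a - mean R x) \<partial>measure_pmf (actual_output P D S)) \<le> ennreal c"
    and "0 \<le> c" and B: "c + 4 * sqrt (ln (real N * real m) / Nstar) \<le> B"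
  shows "worst_case_subopt m Nv Nstar l u k P \<le> ennreal B"
  unfolding worst_case_subopt_def
proof (rule SUP_least, clarify)
  fix arms R S
  assume arms: "set arms \<subseteq> {..<m}" and Nv: "\<forall>a<m. count_list arms a = Nv a"
    and R: "bandit_instance m Nv Nstar R" and req: "is_request l u k arms S"
  obtain a where a: "a < m" "mean R a = best_mean m R" "Nstar \<le> real (Nv a)"
    "\<tau> \<le> sqrt (ln (real N * real m) / Nstar)"
    using R by (rule bandit_instance_best)
  have "\<forall>a<m. num (data arms \<omega>) a = Nv a" "is_request l u k (map fst (data arms \<omega>)) S" for \<omega>
    using Nv req by (auto simp: num_data map_fst_data)
  then have "expected_subopt m arms R S P \<le> ennreal (c + 4 * \<tau>)"
    using P c a \<open>0 \<le> c\<close> by (intro expected_subopt_le[OF arms tau_bounds R]) (auto simp flip: a(2))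
  also have "\<dots> \<le> ennreal B"
    using a(4) B by (intro ennreal_leI) linarith
  finally show "expected_subopt m arms R S P \<le> ennreal B" .
qed

text \<open>The 6 is 2 for twice the bonus of the best arm plus 4 for the failure event; the factor
  3/2 of the noise scale is rounded up to 2.\<close>

lemma worst_case_multi_source_below:
  assumes "0 < \<gamma>" "\<gamma> < 4 / 3 * sqrt (pi * ln (real N * real m) / (real Nmin - real kmax))"
    and B: "6 * sqrt (ln (real N * real m) / Nstar) + 2 * (real kmax * \<gamma> / real Nmin) \<le> B"
  shows "worst_case_subopt m Nv Nstar l u k (multi_source m \<tau> \<gamma>) \<le> ennreal B"
proof (rule worst_case_le)
  fix D :: dataset and S
  assume D: "\<forall>a<m. num D a = Nv a" and req: "is_request l u k (map fst D) S"
  show "set_pmf (actual_output (multi_source m \<tau> \<gamma>) D S) \<subseteq> {..<m}"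
    using m assms(1) request_data(1,2)[OF D req] by (intro set_pmf_multi_source) auto
  fix a R
  assume conf: "confident m \<tau> R D" "confident m \<tau> R (nths D (- S))"
    and a: "a < m" "Nstar \<le> real (Nv a)"
  have "(\<integral>\<^sup>+x. ennreal (mean R a - mean R x) \<partial>measure_pmf (actual_output (multi_source m \<tau> \<gamma>) D S))
    \<le> ennreal (2 * bonus m \<tau> (num D a) + 2 * (real kmax * \<gamma> / real Nmin))"
  proof (rule regret_multi_source_below_threshold[OF a(1) assms(1) conf request_data(1,2)[OF D req]])
    show "3 * real (num (nths D S) b) / (2 * real (num D b)) * \<gamma> \<le> 2 * (real kmax * \<gamma> / real Nmin)"
      if "b \<in> sources m (num (nths D S))" for b
    proof -
      have "real (num (nths D S) b) / real (num D b) \<le> real kmax / real Nmin"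
        using request_data(3)[OF D req that] kmax_less by (intro frac_le) auto
      then have "3 / 2 * (real (num (nths D S) b) / real (num D b)) * \<gamma> \<le> 2 * (real kmax / real Nmin) * \<gamma>"
        using assms(1) by (intro mult_right_mono mult_mono) auto
      then show ?thesis
        by simp
    qed
  qed (use assms(1,2) threshold_data[OF D req] bonus_nonneg in auto)
  also have "\<dots> \<le> ennreal (2 * sqrt (ln (real N * real m) / Nstar) + 2 * (real kmax * \<gamma> / real Nmin))"
    using bonus_le[OF Nstar, of "num D a"] a D by (intro ennreal_leI) auto
  finally show "(\<integral>\<^sup>+x. ennreal (mean R a - mean R x) \<partial>measure_pmf (actual_output (multi_source m \<tau> \<gamma>) D S))
    \<le> ennreal (2 * sqrt (ln (real N * real m) / Nstar) + 2 * (real kmax * \<gamma> / real Nmin))" .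
next
  show "0 \<le> 2 * sqrt (ln (real N * real m) / Nstar) + 2 * (real kmax * \<gamma> / real Nmin)"
    using assms(1) ln_ge_1 Nstar by simp
qed (use B in linarith)

text \<open>The maximum reflects whether the best arm is a source. A source retains at least
  \<open>Nmin - kmax\<close> points; any other arm keeps all its points, and the best arm has at
  least \<open>Nstar\<close> of them.\<close>

lemma worst_case_multi_source_above:
  assumes "0 < \<gamma>" "4 / 3 * sqrt (pi * ln (real N * real m) / (real Nmin - real kmax)) \<le> \<gamma>"
    and B: "6 * max (sqrt (ln (real N * real m) / (real Nmin - real kmax)))
      (sqrt (ln (real N * real m) / Nstar)) \<le> B"
  shows "worst_case_subopt m Nv Nstar l u k (multi_source m \<tau> \<gamma>) \<le> ennreal B"
proof (rule worst_case_le)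
  let ?c = "2 * max (sqrt (ln (real N * real m) / (real Nmin - real kmax)))
      (sqrt (ln (real N * real m) / Nstar))"
  fix D :: dataset and S
  assume D: "\<forall>a<m. num D a = Nv a" and req: "is_request l u k (map fst D) S"
  show "set_pmf (actual_output (multi_source m \<tau> \<gamma>) D S) \<subseteq> {..<m}"
    using m assms(1) request_data(1,2)[OF D req] by (intro set_pmf_multi_source) auto
  fix a R
  assume conf: "confident m \<tau> R D" "confident m \<tau> R (nths D (- S))"
    and a: "a < m" "Nstar \<le> real (Nv a)"
  have "(\<integral>\<^sup>+x. ennreal (mean R a - mean R x) \<partial>measure_pmf (actual_output (multi_source m \<tau> \<gamma>) D S))
    \<le> ennreal (2 * bonus m \<tau> (num (nths D (- S)) a))"
    by (rule regret_multi_source_above_threshold[OF a(1) conf(2) request_data(1,2)[OF D req]])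
      (use assms(2) threshold_data[OF D req] in auto)
  also have "\<dots> \<le> ennreal ?c"
  proof -
    have n: "num (nths D S) a + num (nths D (- S)) a = num D a"
      by (rule num_nths_compl)
    have "bonus m \<tau> (num (nths D (- S)) a)
        \<le> max (sqrt (ln (real N * real m) / (real Nmin - real kmax))) (sqrt (ln (real N * real m) / Nstar))"
    proof (cases "a \<in> sources m (num (nths D S))")
      case True
      then have "real Nmin - real kmax \<le> real (num (nths D (- S)) a)"
        using request_data(3)[OF D req, of a] n by linarith
      then show ?thesis
        using bonus_le[of "real Nmin - real kmax"] kmax_less by (simp add: max.coboundedI1)
    next
      case False
      then have "num (nths D (- S)) a = Nv a"
        using n a D by (auto simp: sources_def)
      then show ?thesis
        using bonus_le[OF Nstar] a by (simp add: max.coboundedI2)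
    qed
    then show ?thesis
      by (intro ennreal_leI) auto
  qed
  finally show "(\<integral>\<^sup>+x. ennreal (mean R a - mean R x) \<partial>measure_pmf (actual_output (multi_source m \<tau> \<gamma>) D S))
    \<le> ennreal ?c" .
next
  show "0 \<le> 2 * max (sqrt (ln (real N * real m) / (real Nmin - real kmax)))
      (sqrt (ln (real N * real m) / Nstar))"
    using ln_ge_1 Nstar by (simp add: max.coboundedI2)
qed (use B in linarith)

text \<open>The witness is \<open>return_learned\<close>. Its bound involves only the
  \<open>Nstar\<close> term, which occurs in both maxima of the theorem, so one estimate covers both
  regimes of \<open>\<gamma>\<close>.\<close>

lemma SubOpt_le:
  assumes "0 \<le> \<epsilon>" "0 \<le> \<delta>" and B: "6 * sqrt (ln (real N * real m) / Nstar) \<le> B"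
  shows "SubOpt m Nv Nstar l u k \<epsilon> \<delta> \<le> ennreal B"
proof -
  have "worst_case_subopt m Nv Nstar l u k (return_learned m \<tau>) \<le> ennreal B"
  proof (rule worst_case_le)
    fix D :: dataset and S a R
    show "set_pmf (actual_output (return_learned m \<tau>) D S) \<subseteq> {..<m}"
      using m by (simp add: actual_output_return_learned argmax_less)
    assume D: "\<forall>a<m. num D a = Nv a" and "confident m \<tau> R D" and a: "a < m" "Nstar \<le> real (Nv a)"
    then have "mean R a - mean R (argmax m (lcb m \<tau> D)) \<le> 2 * bonus m \<tau> (num D a)"
      by (intro regret_argmax_lcb)
    also have "\<dots> \<le> 2 * sqrt (ln (real N * real m) / Nstar)"
      using bonus_le[OF Nstar, of "num D a"] a D by simp
    finally show "(\<integral>\<^sup>+x. ennreal (mean R a - mean R x) \<partial>measure_pmf (actual_output (return_learned m \<tau>) D S))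
      \<le> ennreal (2 * sqrt (ln (real N * real m) / Nstar))"
      by (simp add: actual_output_return_learned ennreal_leI)
  qed (use B ln_ge_1 Nstar in auto)
  then show ?thesis
    unfolding SubOpt_def using m assms(1,2)
    by (intro INF_lower2[of "return_learned m \<tau>"])
       (auto intro: admissible_return_learned UL_return_learned)
qed

end
theorem theorem3p13:
  "\<exists>C::real. 0 < C \<and>
    (\<forall>(m::nat) (Nv :: nat \<Rightarrow> nat) (Nstar::real) (l::nat) (u :: nat \<Rightarrow> nat) (k :: nat \<Rightarrow> nat)
      (N::nat) (Nmin::nat) (kmax::nat) (\<tau>::real) (\<epsilon>::real) (\<delta>::real) (\<gamma>::real) (\<gamma>\<^sub>0::real).
      2 \<le> m \<and> N = (\<Sum>a<m. Nv a) \<and> 0 < Nstar \<and>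
      1 \<le> l \<and> inj_on u {..<l} \<and> (\<forall>i<l. u i < m) \<and> (\<forall>i<l. 1 \<le> k i) \<and>
      Nmin = Min ((\<lambda>i. Nv (u i)) ` {..<l}) \<and> kmax = Max (k ` {..<l}) \<and>
      \<tau> = 1 / real N \<and>
      (\<forall>i<l. real (k i) \<le> real (Nv (u i)) - sqrt (real (Nv (u i)) * ln (real m / \<tau>) / 2)) \<and>
      kmax < Nmin \<and>
      0 < \<epsilon> \<and> 0 < \<delta> \<and> \<delta> < 1.25 \<and>
      \<gamma> = sqrt (2 * ln (1.25 / \<delta>)) / \<epsilon> \<and>
      \<gamma>\<^sub>0 = 4 / 3 * sqrt (pi * ln (real N * real m) / (real Nmin - real kmax))
      \<longrightarrow>
      (\<epsilon> \<le> 1 \<longrightarrow>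
        (\<forall>D S. is_dataset m D \<longrightarrow> (\<forall>a<m. num D a = Nv a) \<longrightarrow> is_request l u k (map fst D) S \<longrightarrow>
           UL_at m \<epsilon> \<delta> (multi_source m \<tau> \<gamma>) D S)) \<and>
      (\<gamma> < \<gamma>\<^sub>0 \<longrightarrow>
        (let B = ennreal (C * max (sqrt (ln (real N * real m) / real Nmin)
                                     + real kmax * \<gamma> / real Nmin)
                                  (sqrt (ln (real N * real m) / Nstar)))
         in worst_case_subopt m Nv Nstar l u k (multi_source m \<tau> \<gamma>) \<le> B \<and>
            SubOpt m Nv Nstar l u k \<epsilon> \<delta> \<le> B)) \<and>
      (\<gamma>\<^sub>0 \<le> \<gamma> \<longrightarrow>
        (let B = ennreal (C * max (sqrt (ln (real N * real m) / (real Nmin - real kmax)))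
                                  (sqrt (ln (real N * real m) / Nstar)))
         in worst_case_subopt m Nv Nstar l u k (multi_source m \<tau> \<gamma>) \<le> B \<and>
            SubOpt m Nv Nstar l u k \<epsilon> \<delta> \<le> B)))"
proof (rule exI[of _ "10::real"], rule conjI, simp, intro allI impI, elim conjE)
  fix m l N Nmin kmax :: nat and Nv u k :: "nat \<Rightarrow> nat" and Nstar \<tau> \<epsilon> \<delta> \<gamma> \<gamma>\<^sub>0 :: real
  assume "2 \<le> m" "N = (\<Sum>a<m. Nv a)" "0 < Nstar" "1 \<le> l" "inj_on u {..<l}" "\<forall>i<l. u i < m"
    "\<forall>i<l. 1 \<le> k i" "Nmin = Min ((\<lambda>i. Nv (u i)) ` {..<l})" "kmax = Max (k ` {..<l})"
    "\<tau> = 1 / real N" "kmax < Nmin"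
    and cond: "\<forall>i<l. real (k i) \<le> real (Nv (u i)) - sqrt (real (Nv (u i)) * ln (real m / \<tau>) / 2)"
    and \<epsilon>: "0 < \<epsilon>" and \<delta>: "0 < \<delta>" "\<delta> < 1.25"
    and \<gamma>: "\<gamma> = sqrt (2 * ln (1.25 / \<delta>)) / \<epsilon>"
    and \<gamma>0: "\<gamma>\<^sub>0 = 4 / 3 * sqrt (pi * ln (real N * real m) / (real Nmin - real kmax))"
  then interpret request_model m Nv Nstar l u k N Nmin kmax \<tau>
    by unfold_locales
  have "0 < \<gamma>"
    unfolding \<gamma> using \<epsilon> \<delta> by simp
  let ?L = "ln (real N * real m)"
  have nonneg: "0 \<le> sqrt (?L / Nstar)" "0 \<le> sqrt (?L / real Nmin)" "0 \<le> real kmax * \<gamma> / real Nmin"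
    using ln_ge_1 Nstar \<open>0 < \<gamma>\<close> by auto
  have le: "6 * b \<le> 10 * max a b" if "0 \<le> b" for a b :: real
    using that by (auto simp: max_def)
  show "(\<epsilon> \<le> 1 \<longrightarrow>
        (\<forall>D S. is_dataset m D \<longrightarrow> (\<forall>a<m. num D a = Nv a) \<longrightarrow> is_request l u k (map fst D) S \<longrightarrow>
           UL_at m \<epsilon> \<delta> (multi_source m \<tau> \<gamma>) D S)) \<and>
      (\<gamma> < \<gamma>\<^sub>0 \<longrightarrow>
        (let B = ennreal (10 * max (sqrt (?L / real Nmin) + real kmax * \<gamma> / real Nmin) (sqrt (?L / Nstar)))
         in worst_case_subopt m Nv Nstar l u k (multi_source m \<tau> \<gamma>) \<le> B \<and>
            SubOpt m Nv Nstar l u k \<epsilon> \<delta> \<le> B)) \<and>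
      (\<gamma>\<^sub>0 \<le> \<gamma> \<longrightarrow>
        (let B = ennreal (10 * max (sqrt (?L / (real Nmin - real kmax))) (sqrt (?L / Nstar)))
         in worst_case_subopt m Nv Nstar l u k (multi_source m \<tau> \<gamma>) \<le> B \<and>
            SubOpt m Nv Nstar l u k \<epsilon> \<delta> \<le> B))"
    unfolding Let_def
  proof (intro conjI impI allI)
    fix D S
    assume "\<epsilon> \<le> 1" "is_dataset m D" "\<forall>a<m. num D a = Nv a" "is_request l u k (map fst D) S"
    then show "UL_at m \<epsilon> \<delta> (multi_source m \<tau> \<gamma>) D S"
      unfolding \<gamma> using \<epsilon> \<delta> cond by (intro UL_at_request)
  next
    let ?max = "max (sqrt (?L / real Nmin) + real kmax * \<gamma> / real Nmin) (sqrt (?L / Nstar))"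
    assume "\<gamma> < \<gamma>\<^sub>0"
    \<comment> \<open>Both \<open>b\<close> and \<open>c\<close> are at most the maximum, so the
      left side is at most 8 times the maximum. This is the largest factor that the constant 10 has
      to dominate.\<close>
    moreover have "6 * b + 2 * c \<le> 10 * max (a + c) b" if "0 \<le> a" "0 \<le> b" "0 \<le> c" for a b c :: real
      using that by (auto simp: max_def)
    then have "6 * sqrt (?L / Nstar) + 2 * (real kmax * \<gamma> / real Nmin) \<le> 10 * ?max"
      using nonneg by blast
    ultimately show "worst_case_subopt m Nv Nstar l u k (multi_source m \<tau> \<gamma>) \<le> ennreal (10 * ?max)"
      using \<open>0 < \<gamma>\<close> unfolding \<gamma>0 by (intro worst_case_multi_source_below)
  next
    show "SubOpt m Nv Nstar l u k \<epsilon> \<delta>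
      \<le> ennreal (10 * max (sqrt (?L / real Nmin) + real kmax * \<gamma> / real Nmin) (sqrt (?L / Nstar)))"
      using \<epsilon> \<delta> le[OF nonneg(1)] by (intro SubOpt_le) auto
  next
    assume "\<gamma>\<^sub>0 \<le> \<gamma>"
    then show "worst_case_subopt m Nv Nstar l u k (multi_source m \<tau> \<gamma>)
      \<le> ennreal (10 * max (sqrt (?L / (real Nmin - real kmax))) (sqrt (?L / Nstar)))"
      using \<open>0 < \<gamma>\<close> max.coboundedI2[OF nonneg(1)]
      unfolding \<gamma>0 by (intro worst_case_multi_source_above) auto
  next
    show "SubOpt m Nv Nstar l u k \<epsilon> \<delta>
      \<le> ennreal (10 * max (sqrt (?L / (real Nmin - real kmax))) (sqrt (?L / Nstar)))"
      using \<epsilon> \<delta> le[OF nonneg(1)] by (intro SubOpt_le) auto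
  qed
qed

end
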